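(* Let $(C_\bullet,\mathcal{B}_\bullet,\mathrm{w})$ and $(C'_\bullet,\mathcal{B}'_\bullet,\mathrm{w}')$ be generic weighted based chain complexes and let $\varphi\colon\mathcal{B}_k\to\mathcal{B}'_k$ (for all $k$) be bijections inducing an isomorphism of chain complexes $C_\bullet\cong C'_\bullet$. Assume further that the bijections respect the ordering of the weights, i.e. for all $(a,b)\in\mathcal{B}_k\times\mathcal{B}_{k-1}$ and $(c,d)\in\mathcal{B}_j\times\mathcal{B}_{j-1}$ we have $\mathrm{w}(a,b)<\mathrm{w}(c,d)$ if and only if $\mathrm{w}'(\varphi(a),\varphi(b))<\mathrm{w}'(\varphi(c),\varphi(d))$. If in the construction of $X(C_\bullet)$ and $Y(C_\bullet)$ the pairs $(a_1,b_1),\dots,(a_n,b_n)$ get simplified in this order, then in the construction of $X(C'_\bullet)$ and $Y(C'_\bullet)$ the pairs $(\varphi(a_1),\varphi(b_1)),\dots,(\varphi(a_n),\varphi(b_n))$ get simplified in this order. Moreover, setting $$d_\varphi(C_\bullet,C'_\bullet):=\max\{|\mathrm{w}(a,b)-\mathrm{w}'(\varphi(a),\varphi(b))| \mid a\in\mathcal{B}_k,\ b\in\mathcal{B}_{k-1}\}$$ (the maximum also running over all $k$), the following inequalities hold for the interleaving distance $d_I$: $$d_I(X(C_\bullet),X(C'_\bullet))\le n\, d_\varphi(C_\bullet,C'_\bullet),\qquad d_I(Y(C_\bullet),Y(C'_\bullet))\le d_\varphi(C_\bullet,C'_\bullet).$$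
   Context: Fix a field $\mathbb{F}$. All chain complexes are over $\mathbb{F}$, non-negative ($C_i=0$ for $i<0$) and compact (finite-dimensional in each degree, zero in all but finitely many degrees); $\mathrm{Ch}$ is their category. A parametrized chain complex is a functor $X\colon[0,\infty)\to\mathrm{Ch}$ from the poset category, with values $X^t$ and internal maps $X^{s\le t}$; morphisms are natural transformations. A factored chain complex is a parametrized chain complex which is tame (for every $t$ the maps $X^{t\le t+\delta}$ are isomorphisms for all small $\delta\ge0$, and for all but finitely many $t>0$ the maps $X^{t-\delta\le t}$ are isomorphisms for all small $\delta\ge 0$) and whose internal maps are all epimorphisms. Interleaving distance: $(X_\varepsilon)^t=X^{t+\varepsilon}$ with the shifted internal maps, $(\phi_\varepsilon)^t=\phi^{t+\varepsilon}$; an $\varepsilon$-interleaving is a pair $\phi\colon X\to Y_\varepsilon$, $\psi\colon Y\to X_\varepsilon$ with $(\psi_\varepsilon\circ\phi)^t=X^{t\le t+2\varepsilon}$ and $(\phi_\varepsilon\circ\psi)^t=Y^{t\le t+2\varepsilon}$ for all $t$; $d_I(X,Y)$ is the infimum of all $\varepsilon>0$ for which an $\varepsilon$-interleaving exists. A weighted based chain complex $(C_\bullet,\mathcal{B}_\bullet,\mathrm{w})$ is a chain complex with a basis $\mathcal{B}_k$ of each $C_k$ and functions (weights) $\mathrm{w}\colon\mathcal{B}_k\times\mathcal{B}_{k-1}\to[0,\infty)$ for all $k$. It is generic if all weights are non-zero and pairwise different (over all pairs and all $k$). For a basis element $b$, $\langle\partial a,b\rangle$ is the coefficient of $b$ in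 $\partial a$. Simplification of a pair: given $a\in\mathcal{B}_n$, $b\in\mathcal{B}_{n-1}$ with $\langle\partial a,b\rangle\ne0$, let $\overline{C}_\bullet$ be the chain complex with $\overline{C}_n=C_n/\mathrm{Span}(a)$, $\overline{C}_{n-1}=C_{n-1}/\mathrm{Span}(\partial a)$, $\overline{C}_k=C_k$ otherwise, with the induced differentials; $q_a\colon C_\bullet\to\overline{C}_\bullet$ is the quotient map. It has bases $\overline{\mathcal{B}}_n=\{[a']\mid a'\in\mathcal{B}_n\setminus\{a\}\}$, $\overline{\mathcal{B}}_{n-1}=\{[b']\mid b'\in\mathcal{B}_{n-1}\setminus\{b\}\}$, $\overline{\mathcal{B}}_k=\mathcal{B}_k$ otherwise, and inherited weights $\mathrm{w}([a'],[b'])=\mathrm{w}(a',b')$. Basis elements of the simplified complex are identified with the elements of $\mathcal{B}_\bullet$ they come from. Sequence of simplified pairs: starting with $C_\bullet$, as long as the differential of the current complex is non-zero, pick among all pairs $(a,b)$ of current basis elements in adjacent degrees with $\langle\partial a,b\rangle\ne0$ (in the current complex and bases) the one of minimal weight, and simplify it. This yields pairs $(a_1,b_1),\dots,(a_n,b_n)$, with $a_i$ of degree $n_i$, and complexes $C_\bullet=C^{(0)},C^{(1)},\dots,C^{(n)}$ with quotient maps $C^{(i-1)}\to C^{(i)}$, where $C^{(n)}$ has zero differential. Construction of $X(C_\bullet)$: put $t_0=0$, $t_i=\mathrm{w}(a_1,b_1)+\dots+\mathrm{w}(a_i,b_i)$, $t_{n+1}=\infty$. Then $X(C_\bullet)^t=C^{(i)}$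 for $t_i\le t<t_{i+1}$, with internal maps the identities and compositions of the quotient maps. Construction of $Y(C_\bullet)$: $Y(C_\bullet)=\bigoplus_{i=1}^n\mathcal{I}^{n_i}[0,w_i,w_i)\oplus\bigoplus_k(\mathcal{I}^k[0,0,\infty))^{\dim C^{(n)}_k}$ with $w_i=\mathrm{w}(a_i,b_i)$. Here $\mathcal{I}^m[0,w,w)$ is the parametrized chain complex equal to $D^m$ ($\mathbb{F}$ in degrees $m,m-1$ with $\partial_m=\mathrm{id}$) on $[0,w)$ with identity internal maps and $0$ on $[w,\infty)$, and $\mathcal{I}^k[0,0,\infty)$ is constantly $S^k$ ($\mathbb{F}$ in degree $k$ only) with identity internal maps. In both constructions the pairs $(a_1,b_1),\dots,(a_n,b_n)$ are said to get simplified in this order. *)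

theory Defs
  imports
    Complex_Main
    "HOL-Library.Extended_Real"
    "HOL-Algebra.AbelCoset"
    "Jordan_Normal_Form.Missing_VectorSpace"
begin

section \<open>Chain complexes\<close>

text \<open>Non-negatively graded complexes over a field \<open>K\<close>. The map \<open>bd C k\<close> goes from degree
  \<open>Suc k\<close> to degree \<open>k\<close>; the differential out of degree \<open>0\<close> is zero and is not represented.\<close>

record ('f, 'v) cplx =
  spc :: "nat \<Rightarrow> ('f, 'v) module"
  bd :: "nat \<Rightarrow> 'v \<Rightarrow> 'v"

definition compact_complex :: "('f, 'm) ring_scheme \<Rightarrow> ('f, 'v, 'z) cplx_scheme \<Rightarrow> bool" where
  "compact_complex K C \<longleftrightarrow>
     (\<forall>k. vectorspace K (spc C k)) \<and>
     (\<forall>k. linear_map K (spc C (Suc k)) (spc C k) (bd C k)) \<and>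
     (\<forall>k. \<forall>x\<in>carrier (spc C (Suc (Suc k))). bd C k (bd C (Suc k) x) = \<zero>\<^bsub>spc C k\<^esub>) \<and>
     (\<forall>k. vectorspace.fin_dim K (spc C k)) \<and>
     finite {k. carrier (spc C k) \<noteq> {\<zero>\<^bsub>spc C k\<^esub>}}"

definition chain_map ::
  "('f, 'm) ring_scheme \<Rightarrow> ('f, 'v, 'z) cplx_scheme \<Rightarrow> ('f, 'w, 'y) cplx_scheme
    \<Rightarrow> (nat \<Rightarrow> 'v \<Rightarrow> 'w) \<Rightarrow> bool" where
  "chain_map K C D f \<longleftrightarrow>
     (\<forall>k. linear_map K (spc C k) (spc D k) (f k)) \<and>
     (\<forall>k. \<forall>x\<in>carrier (spc C (Suc k)). f k (bd C k x) = bd D k (f (Suc k) x))"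

definition chain_iso ::
  "('f, 'm) ring_scheme \<Rightarrow> ('f, 'v, 'z) cplx_scheme \<Rightarrow> ('f, 'w, 'y) cplx_scheme
    \<Rightarrow> (nat \<Rightarrow> 'v \<Rightarrow> 'w) \<Rightarrow> bool" where
  "chain_iso K C D f \<longleftrightarrow>
     chain_map K C D f \<and> (\<forall>k. bij_betw (f k) (carrier (spc C k)) (carrier (spc D k)))"


section \<open>Parametrized chain complexes and the interleaving distance\<close>

text \<open>The data of a functor from the poset \<open>[0, \<infinity>)\<close>: \<open>obj X t\<close> is the value at \<open>t\<close> and \<open>tr X s t\<close>
  the internal map for \<open>s \<le> t\<close>. Only parameters \<open>\<ge> 0\<close> are ever used.\<close>

record ('f, 'v) pcplx =
  obj :: "real \<Rightarrow> ('f, 'v) cplx"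
  tr :: "real \<Rightarrow> real \<Rightarrow> nat \<Rightarrow> 'v \<Rightarrow> 'v"

definition pmorphism ::
  "('f, 'm) ring_scheme \<Rightarrow> ('f, 'v) pcplx \<Rightarrow> ('f, 'w) pcplx
    \<Rightarrow> (real \<Rightarrow> nat \<Rightarrow> 'v \<Rightarrow> 'w) \<Rightarrow> bool" where
  "pmorphism K X Y \<phi> \<longleftrightarrow>
     (\<forall>t\<ge>0. chain_map K (obj X t) (obj Y t) (\<phi> t)) \<and>
     (\<forall>s t k. 0 \<le> s \<longrightarrow> s \<le> t \<longrightarrow>
        (\<forall>x\<in>carrier (spc (obj X s) k). \<phi> t k (tr X s t k x) = tr Y s t k (\<phi> s k x)))"

definition shift :: "real \<Rightarrow> ('f, 'v) pcplx \<Rightarrow> ('f, 'v) pcplx" where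
  "shift \<epsilon> X = \<lparr>obj = (\<lambda>t. obj X (t + \<epsilon>)), tr = (\<lambda>s t. tr X (s + \<epsilon>) (t + \<epsilon>))\<rparr>"

definition interleaving ::
  "('f, 'm) ring_scheme \<Rightarrow> real \<Rightarrow> ('f, 'v) pcplx \<Rightarrow> ('f, 'w) pcplx
    \<Rightarrow> (real \<Rightarrow> nat \<Rightarrow> 'v \<Rightarrow> 'w) \<Rightarrow> (real \<Rightarrow> nat \<Rightarrow> 'w \<Rightarrow> 'v) \<Rightarrow> bool" where
  "interleaving K \<epsilon> X Y \<phi> \<psi> \<longleftrightarrow>
     pmorphism K X (shift \<epsilon> Y) \<phi> \<and>
     pmorphism K Y (shift \<epsilon> X) \<psi> \<and>
     (\<forall>t\<ge>0. \<forall>k. \<forall>x\<in>carrier (spc (obj X t) k).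
        \<psi> (t + \<epsilon>) k (\<phi> t k x) = tr X t (t + 2 * \<epsilon>) k x) \<and>
     (\<forall>t\<ge>0. \<forall>k. \<forall>y\<in>carrier (spc (obj Y t) k).
        \<phi> (t + \<epsilon>) k (\<psi> t k y) = tr Y t (t + 2 * \<epsilon>) k y)"

definition interleaving_dist ::
  "('f, 'm) ring_scheme \<Rightarrow> ('f, 'v) pcplx \<Rightarrow> ('f, 'w) pcplx \<Rightarrow> ereal" where
  "interleaving_dist K X Y = Inf {ereal \<epsilon> | \<epsilon>. 0 < \<epsilon> \<and> (\<exists>\<phi> \<psi>. interleaving K \<epsilon> X Y \<phi> \<psi>)}"


section \<open>Weighted based chain complexes\<close>

text \<open>Bases are indexed families: \<open>gens C k\<close> is the index set of the basis in degree \<open>k\<close>, and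
  \<open>elt C k b\<close> is the basis vector with index \<open>b\<close> (a basis given as a set is the case where
  \<open>elt C k\<close> is the identity). Indices make the identification of the basis elements of a
  simplified complex with the original ones explicit: a class keeps its index. The weight of
  a pair \<open>a \<in> gens C (Suc k)\<close>, \<open>b \<in> gens C k\<close> is \<open>wt C k a b\<close>; such a pair is referred to by the
  triple \<open>(k, a, b)\<close>.\<close>

record ('f, 'v, 'b) wbcplx = "('f, 'v) cplx" +
  gens :: "nat \<Rightarrow> 'b set"
  elt :: "nat \<Rightarrow> 'b \<Rightarrow> 'v"
  wt :: "nat \<Rightarrow> 'b \<Rightarrow> 'b \<Rightarrow> real"

definition basis_pairs :: "('f, 'v, 'b) wbcplx \<Rightarrow> (nat \<times> 'b \<times> 'b) set" where
  "basis_pairs C = {(k, a, b). a \<in> gens C (Suc k) \<and> b \<in> gens C k}"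

definition pair_weight :: "('f, 'v, 'b) wbcplx \<Rightarrow> nat \<times> 'b \<times> 'b \<Rightarrow> real" where
  "pair_weight C = (\<lambda>(k, a, b). wt C k a b)"

definition weighted_based :: "('f, 'm) ring_scheme \<Rightarrow> ('f, 'v, 'b) wbcplx \<Rightarrow> bool" where
  "weighted_based K C \<longleftrightarrow>
     compact_complex K C \<and>
     (\<forall>k. inj_on (elt C k) (gens C k) \<and> vectorspace.basis K (spc C k) (elt C k ` gens C k)) \<and>
     (\<forall>p\<in>basis_pairs C. 0 \<le> pair_weight C p)"

definition generic :: "('f, 'v, 'b) wbcplx \<Rightarrow> bool" where
  "generic C \<longleftrightarrow>
     (\<forall>p\<in>basis_pairs C. pair_weight C p \<noteq> 0) \<and> inj_on (pair_weight C) (basis_pairs C)"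

definition coord ::
  "('f, 'm) ring_scheme \<Rightarrow> ('f, 'v, 'b) wbcplx \<Rightarrow> nat \<Rightarrow> 'v \<Rightarrow> 'b \<Rightarrow> 'f" where
  "coord K C k x =
     (THE c. c \<in> gens C k \<rightarrow>\<^sub>E carrier K \<and>
        x = (\<Oplus>\<^bsub>spc C k\<^esub>g\<in>gens C k. c g \<odot>\<^bsub>spc C k\<^esub> elt C k g))"

definition incidence ::
  "('f, 'm) ring_scheme \<Rightarrow> ('f, 'v, 'b) wbcplx \<Rightarrow> nat \<times> 'b \<times> 'b \<Rightarrow> 'f" where
  "incidence K C = (\<lambda>(k, a, b). coord K C k (bd C k (elt C (Suc k) a)) b)"


section \<open>Simplification of a pair\<close>

text \<open>Quotient spaces. So that a simplification can be iterated without changing the type of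
  vectors, the coset space is transported along the bijection sending each coset to a chosen
  element of it; \<open>qproj V U\<close> is the quotient map.\<close>

definition coset_rep :: "'v set \<Rightarrow> 'v" where
  "coset_rep S = (SOME y. y \<in> S)"

definition qproj :: "('f, 'v) module \<Rightarrow> 'v set \<Rightarrow> 'v \<Rightarrow> 'v" where
  "qproj V U x = coset_rep (U +>\<^bsub>V\<^esub> x)"

definition qspace :: "('f, 'v) module \<Rightarrow> 'v set \<Rightarrow> ('f, 'v) module" where
  "qspace V U =
     \<lparr>carrier = coset_rep ` (a_rcosets\<^bsub>V\<^esub> U),
      mult = (\<lambda>x y. undefined), one = undefined,
      zero = qproj V U \<zero>\<^bsub>V\<^esub>,
      add = (\<lambda>x y. qproj V U (x \<oplus>\<^bsub>V\<^esub> y)),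
      smult = (\<lambda>c x. qproj V U (c \<odot>\<^bsub>V\<^esub> x))\<rparr>"

text \<open>The components \<open>mult\<close> and \<open>one\<close> of a \<open>module\<close> record play no role for vector spaces.\<close>

definition simp_sub ::
  "('f, 'm) ring_scheme \<Rightarrow> ('f, 'v, 'b) wbcplx \<Rightarrow> nat \<times> 'b \<times> 'b \<Rightarrow> nat \<Rightarrow> 'v set" where
  "simp_sub K C = (\<lambda>(k, a, b) j.
     if j = Suc k
     then LinearCombinations.module.span K (spc C (Suc k)) {elt C (Suc k) a}
     else LinearCombinations.module.span K (spc C k) {bd C k (elt C (Suc k) a)})"

definition simp_map ::
  "('f, 'm) ring_scheme \<Rightarrow> ('f, 'v, 'b) wbcplx \<Rightarrow> nat \<times> 'b \<times> 'b \<Rightarrow> nat \<Rightarrow> 'v \<Rightarrow> 'v" where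
  "simp_map K C = (\<lambda>(k, a, b) j.
     if j = Suc k \<or> j = k then qproj (spc C j) (simp_sub K C (k, a, b) j) else (\<lambda>x. x))"

definition simplify ::
  "('f, 'm) ring_scheme \<Rightarrow> ('f, 'v, 'b) wbcplx \<Rightarrow> nat \<times> 'b \<times> 'b \<Rightarrow> ('f, 'v, 'b) wbcplx" where
  "simplify K C = (\<lambda>(k, a, b).
     \<lparr>spc = (\<lambda>j. if j = Suc k \<or> j = k then qspace (spc C j) (simp_sub K C (k, a, b) j)
                 else spc C j),
      bd = (\<lambda>j x. simp_map K C (k, a, b) j (bd C j x)),
      gens = (\<lambda>j. if j = Suc k then gens C j - {a}
                  else if j = k then gens C j - {b}
                  else gens C j),
      elt = (\<lambda>j g. simp_map K C (k, a, b) j (elt C j g)),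
      wt = wt C\<rparr>)"


section \<open>Sequences of simplified pairs\<close>

definition minimal_pair ::
  "('f, 'm) ring_scheme \<Rightarrow> ('f, 'v, 'b) wbcplx \<Rightarrow> nat \<times> 'b \<times> 'b \<Rightarrow> bool" where
  "minimal_pair K C p \<longleftrightarrow>
     p \<in> basis_pairs C \<and> incidence K C p \<noteq> \<zero>\<^bsub>K\<^esub> \<and>
     (\<forall>q\<in>basis_pairs C. incidence K C q \<noteq> \<zero>\<^bsub>K\<^esub> \<longrightarrow> pair_weight C p \<le> pair_weight C q)"

definition zero_differential :: "('f, 'v, 'z) cplx_scheme \<Rightarrow> bool" where
  "zero_differential C \<longleftrightarrow> (\<forall>k. \<forall>x\<in>carrier (spc C (Suc k)). bd C k x = \<zero>\<^bsub>spc C k\<^esub>)"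

fun simplified_pairs ::
  "('f, 'm) ring_scheme \<Rightarrow> ('f, 'v, 'b) wbcplx \<Rightarrow> (nat \<times> 'b \<times> 'b) list \<Rightarrow> bool" where
  "simplified_pairs K C [] \<longleftrightarrow> zero_differential C"
| "simplified_pairs K C (p # ps) \<longleftrightarrow>
     \<not> zero_differential C \<and> minimal_pair K C p \<and> simplified_pairs K (simplify K C p) ps"

definition stage ::
  "('f, 'm) ring_scheme \<Rightarrow> ('f, 'v, 'b) wbcplx \<Rightarrow> (nat \<times> 'b \<times> 'b) list \<Rightarrow> nat
    \<Rightarrow> ('f, 'v, 'b) wbcplx" where
  "stage K C ps i = foldl (simplify K) C (take i ps)"

text \<open>The composite of the \<open>m\<close> successive quotient maps starting at stage \<open>i\<close>.\<close>

primrec stage_map ::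
  "('f, 'm) ring_scheme \<Rightarrow> ('f, 'v, 'b) wbcplx \<Rightarrow> (nat \<times> 'b \<times> 'b) list \<Rightarrow> nat \<Rightarrow> nat
    \<Rightarrow> nat \<Rightarrow> 'v \<Rightarrow> 'v" where
  "stage_map K C ps i 0 = (\<lambda>k x. x)"
| "stage_map K C ps i (Suc m) =
     (\<lambda>k x. simp_map K (stage K C ps (i + m)) (ps ! (i + m)) k (stage_map K C ps i m k x))"


section \<open>The construction X\<close>

definition stage_time :: "('f, 'v, 'b) wbcplx \<Rightarrow> (nat \<times> 'b \<times> 'b) list \<Rightarrow> nat \<Rightarrow> real" where
  "stage_time C ps i = (\<Sum>j<i. pair_weight C (ps ! j))"

definition stage_at :: "('f, 'v, 'b) wbcplx \<Rightarrow> (nat \<times> 'b \<times> 'b) list \<Rightarrow> real \<Rightarrow> nat" where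
  "stage_at C ps t =
     (THE i. i \<le> length ps \<and> stage_time C ps i \<le> t \<and>
        (i < length ps \<longrightarrow> t < stage_time C ps (Suc i)))"

definition X_complex ::
  "('f, 'm) ring_scheme \<Rightarrow> ('f, 'v, 'b) wbcplx \<Rightarrow> (nat \<times> 'b \<times> 'b) list \<Rightarrow> ('f, 'v) pcplx" where
  "X_complex K C ps =
     \<lparr>obj = (\<lambda>t. cplx.truncate (stage K C ps (stage_at C ps t))),
      tr = (\<lambda>s t. stage_map K C ps (stage_at C ps s) (stage_at C ps t - stage_at C ps s))\<rparr>"


section \<open>The construction Y\<close>

definition field_space :: "('f, 'm) ring_scheme \<Rightarrow> ('f, 'f) module" where
  "field_space K =
     \<lparr>carrier = carrier K, mult = mult K, one = one K, zero = zero K, add = add K,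
      smult = mult K\<rparr>"

definition zero_space :: "('f, 'm) ring_scheme \<Rightarrow> ('f, 'f) module" where
  "zero_space K = (field_space K)\<lparr>carrier := {\<zero>\<^bsub>K\<^esub>}\<rparr>"

definition zero_complex :: "('f, 'm) ring_scheme \<Rightarrow> ('f, 'f) cplx" where
  "zero_complex K = \<lparr>spc = (\<lambda>j. zero_space K), bd = (\<lambda>j x. \<zero>\<^bsub>K\<^esub>)\<rparr>"

definition sphere :: "('f, 'm) ring_scheme \<Rightarrow> nat \<Rightarrow> ('f, 'f) cplx" where
  "sphere K k =
     \<lparr>spc = (\<lambda>j. if j = k then field_space K else zero_space K), bd = (\<lambda>j x. \<zero>\<^bsub>K\<^esub>)\<rparr>"

text \<open>\<open>disk K k\<close> is the disk in degrees \<open>Suc k\<close> and \<open>k\<close>, that is, \<open>D\<^sup>m\<close> for \<open>m = Suc k\<close>.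
  Correspondingly \<open>interval_disk K k w\<close> equals \<open>D\<^sup>m\<close> on \<open>[0, w)\<close> and \<open>0\<close> on \<open>[w, \<infinity>)\<close>.\<close>

definition disk :: "('f, 'm) ring_scheme \<Rightarrow> nat \<Rightarrow> ('f, 'f) cplx" where
  "disk K k =
     \<lparr>spc = (\<lambda>j. if j = Suc k \<or> j = k then field_space K else zero_space K),
      bd = (\<lambda>j x. if j = k then x else \<zero>\<^bsub>K\<^esub>)\<rparr>"

definition interval_disk :: "('f, 'm) ring_scheme \<Rightarrow> nat \<Rightarrow> real \<Rightarrow> ('f, 'f) pcplx" where
  "interval_disk K k w =
     \<lparr>obj = (\<lambda>t. if t < w then disk K k else zero_complex K),
      tr = (\<lambda>s t j x. if t < w then x else \<zero>\<^bsub>K\<^esub>)\<rparr>"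

definition constant_sphere :: "('f, 'm) ring_scheme \<Rightarrow> nat \<Rightarrow> ('f, 'f) pcplx" where
  "constant_sphere K k = \<lparr>obj = (\<lambda>t. sphere K k), tr = (\<lambda>s t j x. x)\<rparr>"

text \<open>Direct sums over a finite index set, realised as products.\<close>

definition sum_space :: "'i set \<Rightarrow> ('i \<Rightarrow> ('f, 'v) module) \<Rightarrow> ('f, 'i \<Rightarrow> 'v) module" where
  "sum_space I V =
     \<lparr>carrier = (\<Pi>\<^sub>E i\<in>I. carrier (V i)),
      mult = (\<lambda>x y. undefined), one = undefined,
      zero = (\<lambda>i\<in>I. \<zero>\<^bsub>V i\<^esub>),
      add = (\<lambda>x y. \<lambda>i\<in>I. x i \<oplus>\<^bsub>V i\<^esub> y i),
      smult = (\<lambda>c x. \<lambda>i\<in>I. c \<odot>\<^bsub>V i\<^esub> x i)\<rparr>"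

definition sum_pcplx :: "'i set \<Rightarrow> ('i \<Rightarrow> ('f, 'v) pcplx) \<Rightarrow> ('f, 'i \<Rightarrow> 'v) pcplx" where
  "sum_pcplx I X =
     \<lparr>obj = (\<lambda>t. \<lparr>spc = (\<lambda>k. sum_space I (\<lambda>i. spc (obj (X i) t) k)),
                  bd = (\<lambda>k x. \<lambda>i\<in>I. bd (obj (X i) t) k (x i))\<rparr>),
      tr = (\<lambda>s t k x. \<lambda>i\<in>I. tr (X i) s t k (x i))\<rparr>"

text \<open>The summand \<open>Inl i\<close> belongs to the \<open>i\<close>-th simplified pair (counted from \<open>0\<close>), the summand
  \<open>Inr (k, j)\<close> is the \<open>j\<close>-th copy of the constant sphere of degree \<open>k\<close>.\<close>

definition Y_index ::
  "('f, 'm) ring_scheme \<Rightarrow> ('f, 'v, 'b) wbcplx \<Rightarrow> (nat \<times> 'b \<times> 'b) list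
    \<Rightarrow> (nat + nat \<times> nat) set" where
  "Y_index K C ps =
     Inl ` {..<length ps} \<union>
     Inr ` {(k, j). j < vectorspace.dim K (spc (stage K C ps (length ps)) k)}"

definition Y_complex ::
  "('f, 'm) ring_scheme \<Rightarrow> ('f, 'v, 'b) wbcplx \<Rightarrow> (nat \<times> 'b \<times> 'b) list
    \<Rightarrow> ('f, nat + nat \<times> nat \<Rightarrow> 'f) pcplx" where
  "Y_complex K C ps =
     sum_pcplx (Y_index K C ps)
       (\<lambda>i. case i of
          Inl l \<Rightarrow> interval_disk K (fst (ps ! l)) (pair_weight C (ps ! l))
        | Inr (k, j) \<Rightarrow> constant_sphere K k)"


section \<open>Bijections between bases\<close>

definition pair_map :: "(nat \<Rightarrow> 'b \<Rightarrow> 'c) \<Rightarrow> nat \<times> 'b \<times> 'b \<Rightarrow> nat \<times> 'c \<times> 'c" where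
  "pair_map \<phi> = (\<lambda>(k, a, b). (k, \<phi> (Suc k) a, \<phi> k b))"

definition induces_iso ::
  "('f, 'm) ring_scheme \<Rightarrow> ('f, 'v, 'b) wbcplx \<Rightarrow> ('f, 'w, 'c) wbcplx
    \<Rightarrow> (nat \<Rightarrow> 'b \<Rightarrow> 'c) \<Rightarrow> bool" where
  "induces_iso K C C' \<phi> \<longleftrightarrow>
     (\<exists>f. chain_iso K C C' f \<and> (\<forall>k. \<forall>b\<in>gens C k. f k (elt C k b) = elt C' k (\<phi> k b)))"

text \<open>Inserting \<open>0\<close> only matters if there are no pairs of basis elements in adjacent degrees: then
  the maximum over the empty set is read as \<open>0\<close>.\<close>

definition weight_dist ::
  "('f, 'v, 'b) wbcplx \<Rightarrow> ('f, 'w, 'c) wbcplx \<Rightarrow> (nat \<Rightarrow> 'b \<Rightarrow> 'c) \<Rightarrow> real" where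
  "weight_dist C C' \<phi> =
     Max (insert 0 ((\<lambda>p. \<bar>pair_weight C p - pair_weight C' (pair_map \<phi> p)\<bar>) ` basis_pairs C))"

end

theory Submission
  imports Defs
begin

text \<open>Simplifying a pair depends only on the complex, its bases and the order of the weights. An
  isomorphism matching the bases preserves incidence coefficients, hence minimal pairs, and
  descends to the simplified complexes; so the simplified pairs correspond, and there are
  isomorphisms between the \<open>i\<close>-th stages compatible with the quotient maps.

  The jump times \<open>t\<^sub>i\<close> of the two constructions X differ by at most \<open>n d\<^sub>\<phi>\<close>, so for
  \<open>\<epsilon> \<ge> n d\<^sub>\<phi>\<close> the stage of one at time \<open>t\<close> is not later than the stage of the other at time
  \<open>t + \<epsilon>\<close>. Composing stage isomorphisms with quotient maps yields an \<open>\<epsilon>\<close>-interleaving. The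
  constructions Y are interleaved summand by summand, the \<open>i\<close>-th endpoints \<open>w\<^sub>i\<close> differing by at
  most \<open>d\<^sub>\<phi>\<close>.\<close>

section \<open>Quotients by representatives\<close>

text \<open>Each quotient lives on chosen representatives inside the old space, and the two sides
  choose independently: an isomorphism need not send a representative to a representative. It is
  therefore followed by the quotient map of the target, and the inverse is descended in the same way
  instead of being restricted. The factor \<open>n\<close> arises because jump times are partial
  sums of weights, whose errors add up. Y uses each weight on its own, and a direct sum is
  interleaved with one common epsilon, so only the worst error counts. As the interleaving distance
  is an infimum over positive epsilon, both bounds are approached from above, which also covers the
  bound zero.\<close>

lemma abelian_subgroup_of_subspace:
  assumes "subspace K U V"
  shows "abelian_subgroup U V"
proof -
  interpret vectorspace K V using assms by (simp add: subspace_def)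
  interpret submodule K U V using assms by (simp add: subspace_def)
  have "\<ominus>\<^bsub>V\<^esub> x \<in> U" if "x \<in> U" for x
    by (metis that module.smult_minus_1 R.one_closed R.add.inv_closed smult_closed subset subsetD)
  then have "subgroup U (add_monoid V)"
    by (intro subgroup.intro) (auto simp: a_inv_def[symmetric] subset subsetD)
  then show ?thesis
    by (intro abelian_subgroupI3 additive_subgroupI) (auto intro: M.abelian_group_axioms)
qed

locale quotient_space =
  fixes K :: "('f, 'm) ring_scheme" and V :: "('f, 'v) module" and U :: "'v set"
  assumes sub: "subspace K U V"
begin

sublocale V: vectorspace K V using sub by (simp add: subspace_def)
sublocale U: submodule K U V using sub by (simp add: subspace_def)
sublocale AU: abelian_subgroup U V by (rule abelian_subgroup_of_subspace[OF sub])

abbreviation "q \<equiv> qproj V U"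
abbreviation "Q \<equiv> qspace V U"

lemma q_mem_coset: "x \<in> carrier V \<Longrightarrow> q x \<in> U +>\<^bsub>V\<^esub> x"
  unfolding qproj_def coset_rep_def by (rule someI[where P = "\<lambda>y. y \<in> _"], rule AU.a_rcos_self)

lemma q_closed: "x \<in> carrier V \<Longrightarrow> q x \<in> carrier V"
  by (meson q_mem_coset V.M.a_r_coset_subset_G U.subset subsetD)

text \<open>A representative lies in its coset and distinct cosets are disjoint, so equal
  representatives force equal cosets: the choice loses no information.\<close>

lemma q_eq_iff:
  assumes "x \<in> carrier V" "y \<in> carrier V"
  shows "q x = q y \<longleftrightarrow> x \<ominus>\<^bsub>V\<^esub> y \<in> U"
proof
  assume "q x = q y"
  then have "U +>\<^bsub>V\<^esub> x = U +>\<^bsub>V\<^esub> y"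
    using AU.a_repr_independence'[OF q_mem_coset] assms by metis
  then have "x \<in> U +>\<^bsub>V\<^esub> y"
    using AU.a_rcos_self assms(1) by blast
  then show "x \<ominus>\<^bsub>V\<^esub> y \<in> U"
    using AU.a_rcos_module assms by (simp add: a_minus_def)
next
  assume "x \<ominus>\<^bsub>V\<^esub> y \<in> U"
  then have "x \<in> U +>\<^bsub>V\<^esub> y"
    using AU.a_rcos_module assms by (simp add: a_minus_def)
  then show "q x = q y"
    unfolding qproj_def using AU.a_repr_independence' assms(2) by simp
qed

lemma q_diff_mem: "x \<in> carrier V \<Longrightarrow> q x \<ominus>\<^bsub>V\<^esub> x \<in> U"
  using AU.a_rcos_module q_mem_coset q_closed by (simp add: a_minus_def)

lemma q_q: "x \<in> carrier V \<Longrightarrow> q (q x) = q x"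
  by (simp add: q_closed q_diff_mem q_eq_iff)

lemma carrier_Q: "carrier Q = q ` carrier V"
  by (auto simp: qspace_def qproj_def A_RCOSETS_def' )

lemma zero_Q: "\<zero>\<^bsub>Q\<^esub> = q \<zero>\<^bsub>V\<^esub>" by (simp add: qspace_def)
lemma add_Q: "x \<oplus>\<^bsub>Q\<^esub> y = q (x \<oplus>\<^bsub>V\<^esub> y)" by (simp add: qspace_def)
lemma smult_Q: "c \<odot>\<^bsub>Q\<^esub> x = q (c \<odot>\<^bsub>V\<^esub> x)" by (simp add: qspace_def)

text \<open>The operations of \<open>Q\<close> choose a representative after each step. This rule
  and the next ones discard the inner choices: the error they cause lies in \<open>U\<close>, which
  is closed under the operations.\<close>

lemma q_add: "x \<in> carrier V \<Longrightarrow> y \<in> carrier V \<Longrightarrow> q (q x \<oplus>\<^bsub>V\<^esub> q y) = q (x \<oplus>\<^bsub>V\<^esub> y)"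
proof -
  assume xy: "x \<in> carrier V" "y \<in> carrier V"
  have "(q x \<oplus>\<^bsub>V\<^esub> q y) \<ominus>\<^bsub>V\<^esub> (x \<oplus>\<^bsub>V\<^esub> y) = (q x \<ominus>\<^bsub>V\<^esub> x) \<oplus>\<^bsub>V\<^esub> (q y \<ominus>\<^bsub>V\<^esub> y)"
    using xy by (simp add: a_minus_def q_closed V.M.minus_add V.M.a_ac)
  then show ?thesis
    using xy by (subst q_eq_iff) (auto simp: q_closed q_diff_mem)
qed

lemma q_smult: "c \<in> carrier K \<Longrightarrow> x \<in> carrier V \<Longrightarrow> q (c \<odot>\<^bsub>V\<^esub> q x) = q (c \<odot>\<^bsub>V\<^esub> x)"
proof -
  assume cx: "c \<in> carrier K" "x \<in> carrier V"
  have "(c \<odot>\<^bsub>V\<^esub> q x) \<ominus>\<^bsub>V\<^esub> (c \<odot>\<^bsub>V\<^esub> x) = c \<odot>\<^bsub>V\<^esub> (q x \<ominus>\<^bsub>V\<^esub> x)"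
    using cx by (simp add: a_minus_def q_closed V.smult_r_distr V.smult_r_minus)
  then show ?thesis
    using cx by (subst q_eq_iff) (auto simp: q_closed q_diff_mem)
qed

lemma q_add_l: "x \<in> carrier V \<Longrightarrow> y \<in> carrier V \<Longrightarrow> q (q x \<oplus>\<^bsub>V\<^esub> y) = q (x \<oplus>\<^bsub>V\<^esub> y)"
  by (metis q_add q_q q_closed)

lemma q_add_r: "x \<in> carrier V \<Longrightarrow> y \<in> carrier V \<Longrightarrow> q (x \<oplus>\<^bsub>V\<^esub> q y) = q (x \<oplus>\<^bsub>V\<^esub> y)"
  by (metis q_add q_q q_closed)

lemma vectorspace_Q: "vectorspace K Q"
proof (rule vs_criteria, goal_cases)
  case 1 show ?case by (rule V.field_axioms)
next
  case 4
  show ?case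
  proof
    fix v assume "v \<in> carrier Q"
    then obtain x where x: "x \<in> carrier V" "v = q x" by (auto simp: carrier_Q)
    then have "v \<oplus>\<^bsub>Q\<^esub> q (\<ominus>\<^bsub>V\<^esub> x) = \<zero>\<^bsub>Q\<^esub>"
      by (simp add: add_Q zero_Q q_add V.M.r_neg)
    with x show "\<exists>w\<in>carrier Q. v \<oplus>\<^bsub>Q\<^esub> w = \<zero>\<^bsub>Q\<^esub>" by (auto simp: carrier_Q)
  qed
next
  case 6 then show ?case by (auto simp: carrier_Q add_Q q_add V.M.a_comm)
next
  case 7 then show ?case by (auto simp: carrier_Q add_Q q_add q_add_l q_add_r q_closed V.M.a_assoc)
next
  case 9 then show ?case
    by (auto simp: carrier_Q smult_Q q_closed q_smult V.smult_assoc1[symmetric])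
next
  case 11 then show ?case
    by (auto simp: carrier_Q smult_Q add_Q q_closed q_smult q_add V.smult_l_distr[symmetric])
qed (auto simp: carrier_Q zero_Q add_Q smult_Q q_closed q_add q_smult q_add_l q_add_r q_q
      V.smult_r_distr)

lemma linear_q: "linear_map K V Q q"
  by (intro linear_map.intro mod_hom.intro mod_hom_axioms.intro V.vectorspace_axioms vectorspace_Q
      vectorspace.axioms(1))
    (auto simp: module_hom_def carrier_Q add_Q smult_Q q_add q_smult V.module_axioms)

lemma q_eq_zero_iff: "x \<in> carrier V \<Longrightarrow> q x = \<zero>\<^bsub>Q\<^esub> \<longleftrightarrow> x \<in> U"
  \<comment> \<open>Together these facts say that minus zero is zero, so \<open>x\<close> minus zero
    reduces to \<open>x\<close>.\<close>
  using V.M.l_zero[OF V.M.a_inv_closed[OF V.M.zero_closed]] V.M.r_neg[OF V.M.zero_closed]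
  by (simp add: zero_Q q_eq_iff a_minus_def)

end

section \<open>Linear maps, their inverses, and descent to quotients\<close>

lemma linear_mapI:
  assumes "vectorspace K V" "vectorspace K W"
    and "\<And>x. x \<in> carrier V \<Longrightarrow> f x \<in> carrier W"
    and "\<And>x y. x \<in> carrier V \<Longrightarrow> y \<in> carrier V \<Longrightarrow> f (x \<oplus>\<^bsub>V\<^esub> y) = f x \<oplus>\<^bsub>W\<^esub> f y"
    and "\<And>c x. c \<in> carrier K \<Longrightarrow> x \<in> carrier V \<Longrightarrow> f (c \<odot>\<^bsub>V\<^esub> x) = c \<odot>\<^bsub>W\<^esub> f x"
  shows "linear_map K V W f"
  using assms
  by (auto intro!: linear_map.intro mod_hom.intro mod_hom_axioms.intro vectorspace.axioms(1)
      simp: module_hom_def)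

lemma linear_map_comp:
  assumes f: "linear_map K V W f" and g: "linear_map K W U g"
  shows "linear_map K V U (\<lambda>x. g (f x))"
proof -
  interpret f: linear_map K V W f by fact
  interpret g: linear_map K W U g by fact
  show ?thesis
    by (rule linear_mapI) (auto intro: f.V.vectorspace_axioms g.W.vectorspace_axioms)
qed

lemma linear_map_id: "vectorspace K V \<Longrightarrow> linear_map K V V (\<lambda>x. x)"
  by (rule linear_mapI) auto

lemma linear_map_inv_into:
  assumes f: "linear_map K V W f" and bij: "bij_betw f (carrier V) (carrier W)"
  shows "linear_map K W V (inv_into (carrier V) f)"
proof -
  interpret f: linear_map K V W f by fact
  let ?g = "inv_into (carrier V) f"
  have cl: "?g y \<in> carrier V" and r: "f (?g y) = y" if "y \<in> carrier W" for y
    using that bij by (auto simp: bij_betw_def f_inv_into_f inv_into_into)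
  have l: "?g (f x) = x" if "x \<in> carrier V" for x
    using that bij by (simp add: bij_betw_def)
  show ?thesis
  proof (rule linear_mapI)
    fix x y assume "x \<in> carrier W" "y \<in> carrier W"
    then show "?g (x \<oplus>\<^bsub>W\<^esub> y) = ?g x \<oplus>\<^bsub>V\<^esub> ?g y"
      using l[of "?g x \<oplus>\<^bsub>V\<^esub> ?g y"] by (simp add: cl r)
  next
    fix c x assume "c \<in> carrier K" "x \<in> carrier W"
    then show "?g (c \<odot>\<^bsub>W\<^esub> x) = c \<odot>\<^bsub>V\<^esub> ?g x"
      using l[of "c \<odot>\<^bsub>V\<^esub> ?g x"] by (simp add: cl r)
  qed (auto simp: cl intro: f.V.vectorspace_axioms f.W.vectorspace_axioms)
qed

text \<open>Because a quotient space consists of chosen representatives, the quotient map is a linear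
  map onto a subset of its own domain which fixes that subset. A map that factors through
  the quotient is therefore its own factorisation.\<close>

definition retraction ::
  "('f, 'm) ring_scheme \<Rightarrow> ('f, 'v) module \<Rightarrow> ('f, 'v) module \<Rightarrow> ('v \<Rightarrow> 'v) \<Rightarrow> bool" where
  "retraction K V Q q \<longleftrightarrow>
     linear_map K V Q q \<and> carrier Q \<subseteq> carrier V \<and> (\<forall>x\<in>carrier Q. q x = x)"

lemma retraction_id: "vectorspace K V \<Longrightarrow> retraction K V V (\<lambda>x. x)"
  by (simp add: retraction_def linear_map_id)

lemma (in quotient_space) retraction_q: "retraction K V Q q"
  by (auto simp: retraction_def linear_q carrier_Q q_closed q_q)

text \<open>As \<open>q\<close> fixes \<open>q x\<close>, the difference of \<open>q x\<close> and
  \<open>x\<close> lies in the kernel of \<open>q\<close>, hence in that of \<open>h\<close>.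
  Linearity on \<open>Q\<close> follows by removing the \<open>q\<close> hidden in its
  operations.\<close>

lemma retraction_descend:
  assumes "retraction K V Q q" "linear_map K V W h"
    and ker: "\<And>x. x \<in> carrier V \<Longrightarrow> q x = \<zero>\<^bsub>Q\<^esub> \<Longrightarrow> h x = \<zero>\<^bsub>W\<^esub>"
  shows "x \<in> carrier V \<Longrightarrow> h (q x) = h x" and "linear_map K Q W h"
proof -
  interpret V: vectorspace K V using assms(2) by (rule linear_map.axioms)
  interpret W: vectorspace K W using assms(2) by (rule linear_map.axioms)
  interpret Q: vectorspace K Q using assms(1) by (auto simp: retraction_def dest: linear_map.axioms)
  interpret q: linear_map K V Q q using assms(1) by (simp add: retraction_def)
  interpret h: linear_map K V W h by fact
  have sub: "x \<in> carrier Q \<Longrightarrow> x \<in> carrier V" and qq: "x \<in> carrier Q \<Longrightarrow> q x = x" for x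
    using assms(1) by (auto simp: retraction_def)
  have hq: "h (q x) = h x" if x: "x \<in> carrier V" for x
  proof -
    have qx: "q x \<in> carrier V" using x sub by simp
    have "q (q x \<ominus>\<^bsub>V\<^esub> x) = q x \<ominus>\<^bsub>Q\<^esub> q x"
      using x qx qq by simp
    also have "\<dots> = \<zero>\<^bsub>Q\<^esub>" using x by (simp add: a_minus_def Q.M.r_neg)
    finally have "h (q x \<ominus>\<^bsub>V\<^esub> x) = \<zero>\<^bsub>W\<^esub>" using x qx by (intro ker) (auto simp: a_minus_def)
    then have "h (q x) \<ominus>\<^bsub>W\<^esub> h x = \<zero>\<^bsub>W\<^esub>" using x qx by simp
    then show ?thesis using x qx by (metis W.M.minus_equality W.M.minus_minus h.f_im W.M.a_inv_closed a_minus_def)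
  qed
  then show "x \<in> carrier V \<Longrightarrow> h (q x) = h x" .
  show "linear_map K Q W h"
  proof (rule linear_mapI)
    fix x y assume xy: "x \<in> carrier Q" "y \<in> carrier Q"
    then have "h (x \<oplus>\<^bsub>Q\<^esub> y) = h (q (x \<oplus>\<^bsub>V\<^esub> y))" using sub qq by simp
    also have "\<dots> = h (x \<oplus>\<^bsub>V\<^esub> y)" using xy by (intro hq) (simp add: sub)
    finally show "h (x \<oplus>\<^bsub>Q\<^esub> y) = h x \<oplus>\<^bsub>W\<^esub> h y" using xy sub by simp
  next
    fix c x assume cx: "c \<in> carrier K" "x \<in> carrier Q"
    then have "h (c \<odot>\<^bsub>Q\<^esub> x) = h (q (c \<odot>\<^bsub>V\<^esub> x))" using sub qq by simp
    also have "\<dots> = h (c \<odot>\<^bsub>V\<^esub> x)" using cx by (intro hq) (simp add: sub)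
    finally show "h (c \<odot>\<^bsub>Q\<^esub> x) = c \<odot>\<^bsub>W\<^esub> h x" using cx sub by simp
  qed (auto simp: sub intro: Q.vectorspace_axioms W.vectorspace_axioms)
qed

section \<open>Bases indexed by a finite set\<close>

definition lcomb ::
  "('f, 'v, 'z) module_scheme \<Rightarrow> 'b set \<Rightarrow> ('b \<Rightarrow> 'v) \<Rightarrow> ('b \<Rightarrow> 'f) \<Rightarrow> 'v" where
  "lcomb V G e c = (\<Oplus>\<^bsub>V\<^esub>g\<in>G. c g \<odot>\<^bsub>V\<^esub> e g)"

text \<open>Unique expansion stands in for independence and spanning, since it passes to quotients
  and along isomorphisms by computing coefficients. Coefficient functions are compared on
  \<open>G\<close> only, so their values elsewhere do not matter.\<close>

definition indexed_basis ::
  "('f, 'm) ring_scheme \<Rightarrow> ('f, 'v, 'z) module_scheme \<Rightarrow> 'b set \<Rightarrow> ('b \<Rightarrow> 'v) \<Rightarrow> bool" where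
  "indexed_basis K V G e \<longleftrightarrow>
     vectorspace K V \<and> finite G \<and> e \<in> G \<rightarrow> carrier V \<and>
     (\<forall>x\<in>carrier V. \<exists>c\<in>G \<rightarrow> carrier K. x = lcomb V G e c) \<and>
     (\<forall>c\<in>G \<rightarrow> carrier K. \<forall>d\<in>G \<rightarrow> carrier K. lcomb V G e c = lcomb V G e d \<longrightarrow> (\<forall>g\<in>G. c g = d g))"

context vectorspace
begin

lemma lcomb_closed: "e \<in> G \<rightarrow> carrier V \<Longrightarrow> c \<in> G \<rightarrow> carrier K \<Longrightarrow> lcomb V G e c \<in> carrier V"
  unfolding lcomb_def by (auto intro!: M.finsum_closed)

lemma lcomb_cong:
  assumes "e \<in> G \<rightarrow> carrier V" "d \<in> G \<rightarrow> carrier K"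
    and "\<And>g. g \<in> G \<Longrightarrow> c g = d g"
  shows "lcomb V G e c = lcomb V G e d"
  unfolding lcomb_def using assms by (intro M.finsum_cong') auto

lemma lcomb_add_smult:
  assumes "finite G" "e \<in> G \<rightarrow> carrier V" "c \<in> G \<rightarrow> carrier K" "d \<in> G \<rightarrow> carrier K" "s \<in> carrier K"
  shows "lcomb V G e (\<lambda>g. c g \<oplus>\<^bsub>K\<^esub> s \<otimes>\<^bsub>K\<^esub> d g) = lcomb V G e c \<oplus>\<^bsub>V\<^esub> s \<odot>\<^bsub>V\<^esub> lcomb V G e d"
proof -
  have [simp]: "c g \<in> carrier K" "d g \<in> carrier K" "e g \<in> carrier V" if "g \<in> G" for g
    using assms that by auto
  have "lcomb V G e (\<lambda>g. c g \<oplus>\<^bsub>K\<^esub> s \<otimes>\<^bsub>K\<^esub> d g)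
      = (\<Oplus>\<^bsub>V\<^esub>g\<in>G. c g \<odot>\<^bsub>V\<^esub> e g \<oplus>\<^bsub>V\<^esub> s \<odot>\<^bsub>V\<^esub> (d g \<odot>\<^bsub>V\<^esub> e g))"
    unfolding lcomb_def using assms(5)
    by (intro M.finsum_cong') (auto simp: smult_l_distr smult_assoc1)
  also have "\<dots> = lcomb V G e c \<oplus>\<^bsub>V\<^esub> (\<Oplus>\<^bsub>V\<^esub>g\<in>G. s \<odot>\<^bsub>V\<^esub> (d g \<odot>\<^bsub>V\<^esub> e g))"
    unfolding lcomb_def using assms(5) by (intro M.finsum_addf) auto
  also have "(\<Oplus>\<^bsub>V\<^esub>g\<in>G. s \<odot>\<^bsub>V\<^esub> (d g \<odot>\<^bsub>V\<^esub> e g)) = s \<odot>\<^bsub>V\<^esub> lcomb V G e d"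
    unfolding lcomb_def using assms(1,5) by (intro finsum_smult_ldistr[symmetric]) auto
  finally show ?thesis .
qed

lemma lcomb_remove:
  assumes "finite G" "b \<in> G" "e \<in> G \<rightarrow> carrier V" "c \<in> G \<rightarrow> carrier K" "c b = \<zero>\<^bsub>K\<^esub>"
  shows "lcomb V (G - {b}) e c = lcomb V G e c"
proof -
  have "lcomb V G e c = lcomb V (insert b (G - {b})) e c"
    using assms(2) by (simp add: insert_absorb)
  also have "\<dots> = c b \<odot>\<^bsub>V\<^esub> e b \<oplus>\<^bsub>V\<^esub> lcomb V (G - {b}) e c"
    unfolding lcomb_def using assms by (intro M.finsum_insert) auto
  also have "\<dots> = lcomb V (G - {b}) e c"
    using assms lcomb_closed[of e "G - {b}" c] by (auto simp: Pi_iff)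
  finally show ?thesis by simp
qed

lemma lcomb_unit:
  assumes "finite G" "b \<in> G" "e \<in> G \<rightarrow> carrier V"
  shows "lcomb V G e (\<lambda>g. if g = b then \<one>\<^bsub>K\<^esub> else \<zero>\<^bsub>K\<^esub>) = e b"
proof -
  have "lcomb V G e (\<lambda>g. if g = b then \<one>\<^bsub>K\<^esub> else \<zero>\<^bsub>K\<^esub>) = (\<Oplus>\<^bsub>V\<^esub>g\<in>G. if b = g then e g else \<zero>\<^bsub>V\<^esub>)"
    unfolding lcomb_def using assms by (intro M.finsum_cong') (auto simp: Pi_iff)
  then show ?thesis using assms M.finsum_singleton[of b G e] by simp
qed

lemma lcomb_reindex:
  assumes "bij_betw h H G" "e \<in> G \<rightarrow> carrier V" "c \<in> G \<rightarrow> carrier K"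
  shows "lcomb V G e c = lcomb V H (\<lambda>i. e (h i)) (\<lambda>i. c (h i))"
proof -
  have "(\<lambda>g. c g \<odot>\<^bsub>V\<^esub> e g) \<in> h ` H \<rightarrow> carrier V" "inj_on h H" "G = h ` H"
    using assms by (auto simp: bij_betw_def)
  then show ?thesis unfolding lcomb_def by (simp add: M.finsum_reindex)
qed

end

lemma lcomb_image:
  assumes T: "linear_map K V W T"
    and "finite G" "e \<in> G \<rightarrow> carrier V" "c \<in> G \<rightarrow> carrier K"
  shows "T (lcomb V G e c) = lcomb W G (\<lambda>g. T (e g)) c"
  using assms(2-4)
proof (induction rule: finite_induct)
  case empty
  interpret linear_map K V W T by fact
  show ?case by (simp add: lcomb_def)
next
  interpret V: vectorspace K V using T by (rule linear_map.axioms)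
  interpret W: vectorspace K W using T by (rule linear_map.axioms)
  interpret T: linear_map K V W T by fact
  case (insert b G)
  have *: "e \<in> G \<rightarrow> carrier V" "c \<in> G \<rightarrow> carrier K" "(\<lambda>g. T (e g)) \<in> G \<rightarrow> carrier W"
    "c b \<in> carrier K" "e b \<in> carrier V" using insert by auto
  have "lcomb V (insert b G) e c = c b \<odot>\<^bsub>V\<^esub> e b \<oplus>\<^bsub>V\<^esub> lcomb V G e c"
    unfolding lcomb_def using insert * by (intro V.M.finsum_insert) auto
  moreover have "lcomb W (insert b G) (\<lambda>g. T (e g)) c = c b \<odot>\<^bsub>W\<^esub> T (e b) \<oplus>\<^bsub>W\<^esub> lcomb W G (\<lambda>g. T (e g)) c"
    unfolding lcomb_def using insert * by (intro W.M.finsum_insert) auto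
  ultimately show ?case using insert.IH * V.lcomb_closed[OF *(1,2)] by simp
qed

section \<open>Coordinates in an indexed basis\<close>

definition coords ::
  "('f, 'm) ring_scheme \<Rightarrow> ('f, 'v, 'z) module_scheme \<Rightarrow> 'b set \<Rightarrow> ('b \<Rightarrow> 'v) \<Rightarrow> 'v \<Rightarrow> 'b \<Rightarrow> 'f" where
  "coords K V G e x = (THE c. c \<in> G \<rightarrow>\<^sub>E carrier K \<and> x = lcomb V G e c)"

lemma coord_eq_coords: "coord K C k = coords K (spc C k) (gens C k) (elt C k)"
  by (simp add: coord_def coords_def lcomb_def fun_eq_iff)

lemma indexed_basis_coords:
  assumes B: "indexed_basis K V G e" and x: "x \<in> carrier V"
  shows "coords K V G e x \<in> G \<rightarrow> carrier K" "x = lcomb V G e (coords K V G e x)"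
    "c \<in> G \<rightarrow> carrier K \<Longrightarrow> x = lcomb V G e c \<Longrightarrow> g \<in> G \<Longrightarrow> coords K V G e x g = c g"
proof -
  interpret V: vectorspace K V using B by (simp add: indexed_basis_def)
  have e: "e \<in> G \<rightarrow> carrier V" using B by (simp add: indexed_basis_def)
  have uniq: "\<And>g. g \<in> G \<Longrightarrow> c g = d g"
    if "c \<in> G \<rightarrow> carrier K" "d \<in> G \<rightarrow> carrier K" "lcomb V G e c = lcomb V G e d" for c d
    using B that by (simp add: indexed_basis_def)
  obtain d where d: "d \<in> G \<rightarrow> carrier K" "x = lcomb V G e d"
    using B x by (auto simp: indexed_basis_def)
  have "\<exists>!c. c \<in> G \<rightarrow>\<^sub>E carrier K \<and> x = lcomb V G e c"
  proof (rule ex1I[of _ "restrict d G"])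
    have "lcomb V G e (restrict d G) = lcomb V G e d" using e d by (intro V.lcomb_cong) auto
    then show "restrict d G \<in> G \<rightarrow>\<^sub>E carrier K \<and> x = lcomb V G e (restrict d G)" using d by auto
  next
    fix c assume c: "c \<in> G \<rightarrow>\<^sub>E carrier K \<and> x = lcomb V G e c"
    then have "c g = d g" if "g \<in> G" for g using uniq[of c d] d that by (auto simp: PiE_def)
    then show "c = restrict d G" using c by (intro ext) (auto simp: restrict_def PiE_def extensional_def)
  qed
  then have *: "coords K V G e x \<in> G \<rightarrow>\<^sub>E carrier K \<and> x = lcomb V G e (coords K V G e x)"
    unfolding coords_def by (rule theI')
  then show "coords K V G e x \<in> G \<rightarrow> carrier K" "x = lcomb V G e (coords K V G e x)" by auto
  with * show "c \<in> G \<rightarrow> carrier K \<Longrightarrow> x = lcomb V G e c \<Longrightarrow> g \<in> G \<Longrightarrow> coords K V G e x g = c g"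
    using uniq by metis
qed

lemma coords_basis_vector:
  assumes B: "indexed_basis K V G e" and b: "b \<in> G"
  shows "coords K V G e (e b) b = \<one>\<^bsub>K\<^esub>"
proof -
  interpret V: vectorspace K V using B by (simp add: indexed_basis_def)
  have e: "e \<in> G \<rightarrow> carrier V" and fin: "finite G" using B by (simp_all add: indexed_basis_def)
  let ?c = "\<lambda>g. if g = b then \<one>\<^bsub>K\<^esub> else \<zero>\<^bsub>K\<^esub>"
  have "coords K V G e (e b) b = ?c b"
    using e b V.lcomb_unit[OF fin b e]
    by (intro indexed_basis_coords(3)[OF B]) auto
  then show ?thesis by simp
qed

text \<open>\<open>f\<close> turns the expansion of \<open>x\<close> into an expansion of
  \<open>f x\<close> with relabelled coefficients, and expansions in the target are unique.\<close>

lemma coords_iso: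
  assumes B: "indexed_basis K V G e" and B': "indexed_basis K W H e'"
    and f: "linear_map K V W f" and \<phi>: "bij_betw \<phi> G H"
    and fe: "\<And>g. g \<in> G \<Longrightarrow> f (e g) = e' (\<phi> g)"
    and x: "x \<in> carrier V" and g: "g \<in> G"
  shows "coords K W H e' (f x) (\<phi> g) = coords K V G e x g"
proof -
  interpret V: vectorspace K V using B by (simp add: indexed_basis_def)
  interpret W: vectorspace K W using B' by (simp add: indexed_basis_def)
  interpret f: linear_map K V W f by fact
  have e: "e \<in> G \<rightarrow> carrier V" "e' \<in> H \<rightarrow> carrier W" and fin: "finite G"
    using B B' by (simp_all add: indexed_basis_def)
  have \<phi>H: "\<phi> i \<in> H" if "i \<in> G" for i using \<phi> that by (auto simp: bij_betw_def)
  let ?d = "coords K W H e' (f x)"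
  have fx: "f x \<in> carrier W" using x by simp
  note d = indexed_basis_coords[OF B' fx]
  note c = indexed_basis_coords[OF B x]
  have e\<phi>: "(\<lambda>i. e' (\<phi> i)) \<in> G \<rightarrow> carrier W" using e \<phi>H by auto
  \<comment> \<open>The coefficients of \<open>x\<close>, relabelled by the inverse of
    \<open>\<phi>\<close> so as to be indexed by \<open>H\<close>.\<close>
  define c' where "c' h = coords K V G e x (inv_into G \<phi> h)" for h
  have c'\<phi>: "c' (\<phi> i) = coords K V G e x i" if "i \<in> G" for i
    using \<phi> that by (simp add: c'_def bij_betw_def)
  have c'P: "c' \<in> H \<rightarrow> carrier K"
    using c(1) \<phi> by (auto simp: c'_def bij_betw_def intro!: inv_into_into)
  have "f x = lcomb W G (\<lambda>i. f (e i)) (coords K V G e x)"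
    using lcomb_image[OF f fin e(1) c(1)] c(2) by simp
  also have "\<dots> = lcomb W G (\<lambda>i. e' (\<phi> i)) (\<lambda>i. c' (\<phi> i))"
    unfolding lcomb_def using e\<phi> c(1) \<phi>H c'P
    by (intro W.M.finsum_cong') (auto simp: fe c'\<phi> Pi_iff)
  also have "\<dots> = lcomb W H e' c'"
    using W.lcomb_reindex[OF \<phi> e(2) c'P] by simp
  finally show ?thesis using d(3)[OF c'P _ \<phi>H[OF g]] c'\<phi>[OF g] by simp
qed

text \<open>An exchange argument: modulo \<open>u\<close> the vector \<open>e b\<close> is a
  combination of the others, because \<open>u\<close> has a non-zero coefficient at
  \<open>b\<close>. With a general \<open>u\<close> this serves both degrees changed by a
  simplification, where \<open>u\<close> is the vector of \<open>a\<close> or its boundary.\<close>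

lemma indexed_basis_quotient:
  assumes B: "indexed_basis K V G e" and q: "linear_map K V Q q"
    and surj: "q ` carrier V = carrier Q"
    and u: "u \<in> carrier V" and ker: "\<And>x. x \<in> carrier V \<Longrightarrow> q x = \<zero>\<^bsub>Q\<^esub> \<longleftrightarrow> (\<exists>s\<in>carrier K. x = s \<odot>\<^bsub>V\<^esub> u)"
    and b: "b \<in> G" and nz: "coords K V G e u b \<noteq> \<zero>\<^bsub>K\<^esub>"
  shows "indexed_basis K Q (G - {b}) (\<lambda>g. q (e g))"
proof -
  interpret V: vectorspace K V using q by (rule linear_map.axioms)
  interpret Q: vectorspace K Q using q by (rule linear_map.axioms)
  interpret q: linear_map K V Q q by fact
  have e: "e \<in> G \<rightarrow> carrier V" and fin: "finite G" using B by (simp_all add: indexed_basis_def)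
  have e': "e \<in> G - {b} \<rightarrow> carrier V" and fin': "finite (G - {b})" using e fin by auto
  define r where "r = coords K V G e u"
  have r: "r \<in> G \<rightarrow> carrier K" "u = lcomb V G e r" "r b \<noteq> \<zero>\<^bsub>K\<^esub>"
    using indexed_basis_coords[OF B u] nz by (auto simp: r_def)
  have rb: "r b \<in> carrier K" using r b by auto
  have qu: "q u = \<zero>\<^bsub>Q\<^esub>" using ker[OF u] u V.one_closed V.smult_one by metis
  have ex: "\<exists>c\<in>G - {b} \<rightarrow> carrier K. y = lcomb Q (G - {b}) (\<lambda>g. q (e g)) c" if y: "y \<in> carrier Q" for y
  proof -
    obtain x where x: "x \<in> carrier V" "y = q x" using y surj by auto
    obtain d where d: "d \<in> G \<rightarrow> carrier K" "x = lcomb V G e d"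
      using indexed_basis_coords[OF B x(1)] by blast
    have db: "d b \<in> carrier K" using d b by auto
    \<comment> \<open>The multiple of \<open>u\<close> that cancels the coefficient of
      \<open>x\<close> at \<open>b\<close>; adding it leaves \<open>q x\<close> unchanged.\<close>
    define s where "s = \<ominus>\<^bsub>K\<^esub> (d b \<otimes>\<^bsub>K\<^esub> inv\<^bsub>K\<^esub> r b)"
    have rU: "r b \<in> Units K" using rb r(3) V.field_Units by auto
    then have s: "s \<in> carrier K" using db by (simp add: s_def)
    have srb: "s \<otimes>\<^bsub>K\<^esub> r b = \<ominus>\<^bsub>K\<^esub> d b"
      using db rb rU by (simp add: s_def V.l_minus V.R.m_assoc)
    define c where "c g = d g \<oplus>\<^bsub>K\<^esub> s \<otimes>\<^bsub>K\<^esub> r g" for g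
    have c: "c \<in> G \<rightarrow> carrier K" using d(1) r(1) s by (auto simp: c_def Pi_iff)
    have cb: "c b = \<zero>\<^bsub>K\<^esub>" using db by (simp add: c_def srb V.R.r_neg)
    have "lcomb V (G - {b}) e c = lcomb V G e c" by (rule V.lcomb_remove[OF fin b e c cb])
    also have "\<dots> = x \<oplus>\<^bsub>V\<^esub> s \<odot>\<^bsub>V\<^esub> u"
      unfolding c_def using V.lcomb_add_smult[OF fin e d(1) r(1) s] d(2) r(2) by simp
    finally have "q (lcomb V (G - {b}) e c) = y" using x u s qu by simp
    moreover have "c \<in> G - {b} \<rightarrow> carrier K" using c by auto
    ultimately show ?thesis using lcomb_image[OF q fin' e'] by metis
  qed
  have uniq: "c g = d g"
    if cd: "c \<in> G - {b} \<rightarrow> carrier K" "d \<in> G - {b} \<rightarrow> carrier K"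
      "lcomb Q (G - {b}) (\<lambda>g. q (e g)) c = lcomb Q (G - {b}) (\<lambda>g. q (e g)) d" and g: "g \<in> G - {b}" for c d g
  proof -
    \<comment> \<open>Extending by zero at \<open>b\<close> lifts both combinations to
      \<open>V\<close>. Their difference is a multiple of \<open>u\<close>, and comparing
      coefficients at \<open>b\<close> shows that the multiple is zero.\<close>
    define c0 d0 where "c0 = c(b := \<zero>\<^bsub>K\<^esub>)" and "d0 = d(b := \<zero>\<^bsub>K\<^esub>)"
    have c0: "c0 \<in> G \<rightarrow> carrier K" and d0: "d0 \<in> G \<rightarrow> carrier K"
      using cd by (auto simp: c0_def d0_def)
    have c0G: "c0 \<in> G - {b} \<rightarrow> carrier K" and d0G: "d0 \<in> G - {b} \<rightarrow> carrier K"
      using c0 d0 by auto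
    let ?x = "lcomb V G e c0" and ?y = "lcomb V G e d0"
    have x: "?x \<in> carrier V" and y: "?y \<in> carrier V" using V.lcomb_closed e c0 d0 by auto
    have "q ?x = lcomb Q (G - {b}) (\<lambda>g. q (e g)) c0"
      using V.lcomb_remove[OF fin b e c0] lcomb_image[OF q fin' e' c0G] by (simp add: c0_def)
    also have "\<dots> = lcomb Q (G - {b}) (\<lambda>g. q (e g)) c"
      using e' cd by (intro Q.lcomb_cong) (auto simp: c0_def)
    also have "\<dots> = lcomb Q (G - {b}) (\<lambda>g. q (e g)) d0"
      unfolding cd(3) using e' cd d0G by (intro Q.lcomb_cong) (auto simp: d0_def)
    also have "\<dots> = q ?y"
      using V.lcomb_remove[OF fin b e d0] lcomb_image[OF q fin' e' d0G] by (simp add: d0_def)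
    finally have "q (?x \<ominus>\<^bsub>V\<^esub> ?y) = \<zero>\<^bsub>Q\<^esub>" using x y by (simp add: a_minus_def Q.M.r_neg)
    then obtain s where s: "s \<in> carrier K" "?x \<ominus>\<^bsub>V\<^esub> ?y = s \<odot>\<^bsub>V\<^esub> u"
      using ker[of "?x \<ominus>\<^bsub>V\<^esub> ?y"] x y by (auto simp: a_minus_def)
    have "?x = ?y \<oplus>\<^bsub>V\<^esub> (?x \<ominus>\<^bsub>V\<^esub> ?y)"
      using x y by (simp add: a_minus_def V.M.a_lcomm V.M.r_neg)
    also have "\<dots> = lcomb V G e (\<lambda>g. d0 g \<oplus>\<^bsub>K\<^esub> s \<otimes>\<^bsub>K\<^esub> r g)"
      using V.lcomb_add_smult[OF fin e d0 r(1) s(1)] s(2) r(2) by simp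
    finally have eq: "c0 h = d0 h \<oplus>\<^bsub>K\<^esub> s \<otimes>\<^bsub>K\<^esub> r h" if "h \<in> G" for h
    proof -
      assume "lcomb V G e c0 = lcomb V G e (\<lambda>g. d0 g \<oplus>\<^bsub>K\<^esub> s \<otimes>\<^bsub>K\<^esub> r g)"
      moreover have "(\<lambda>g. d0 g \<oplus>\<^bsub>K\<^esub> s \<otimes>\<^bsub>K\<^esub> r g) \<in> G \<rightarrow> carrier K" using d0 r(1) s by (auto simp: Pi_iff)
      ultimately show ?thesis using B c0 that unfolding indexed_basis_def by blast
    qed
    have "s \<otimes>\<^bsub>K\<^esub> r b = \<zero>\<^bsub>K\<^esub>" using eq[OF b] s rb by (simp add: c0_def d0_def)
    then have "s = \<zero>\<^bsub>K\<^esub>" using s rb r(3) V.integral by blast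
    then show "c g = d g" using eq[of g] g cd r by (auto simp: c0_def d0_def Pi_iff)
  qed
  show ?thesis
    unfolding indexed_basis_def using ex uniq fin e Q.vectorspace_axioms by auto
qed

section \<open>Chain maps and based complexes\<close>

lemma chain_map_closed:
  assumes "chain_map K C D f" "x \<in> carrier (spc C k)"
  shows "f k x \<in> carrier (spc D k)"
proof -
  interpret linear_map K "spc C k" "spc D k" "f k" using assms by (simp add: chain_map_def)
  show ?thesis using assms by simp
qed

lemma chain_map_comp:
  assumes f: "chain_map K C D f" and g: "chain_map K D E g"
  shows "chain_map K C E (\<lambda>k x. g k (f k x))"
  using f g chain_map_closed[OF f] by (auto simp: chain_map_def intro: linear_map_comp)

lemma chain_map_id: "(\<And>j. vectorspace K (spc C j)) \<Longrightarrow> chain_map K C C (\<lambda>j x. x)"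
  by (simp add: chain_map_def linear_map_id)

text \<open>\<open>inv_into\<close> undoes \<open>f\<close> only on the carrier, hence the explicit
  assumption that boundaries stay inside it.\<close>

lemma chain_iso_inv:
  assumes "chain_iso K C D f" and bd: "\<And>k x. x \<in> carrier (spc C (Suc k)) \<Longrightarrow> bd C k x \<in> carrier (spc C k)"
  shows "chain_map K D C (\<lambda>k. inv_into (carrier (spc C k)) (f k))"
proof -
  let ?g = "\<lambda>k. inv_into (carrier (spc C k)) (f k)"
  have lin: "linear_map K (spc C k) (spc D k) (f k)"
    and bij: "bij_betw (f k) (carrier (spc C k)) (carrier (spc D k))"
    and ch: "x \<in> carrier (spc C (Suc k)) \<Longrightarrow> f k (bd C k x) = bd D k (f (Suc k) x)" for k x
    using assms(1) by (auto simp: chain_iso_def chain_map_def)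
  have "?g k (bd D k y) = bd C k (?g (Suc k) y)" if "y \<in> carrier (spc D (Suc k))" for k y
  proof -
    have "y \<in> f (Suc k) ` carrier (spc C (Suc k))"
      using that bij[of "Suc k"] by (simp add: bij_betw_def)
    then obtain x where x: "x \<in> carrier (spc C (Suc k))" "y = f (Suc k) x" by blast
    then have "?g k (bd D k y) = bd C k x"
      using bij[of k] bd[OF x(1)] ch[OF x(1)] by (simp add: bij_betw_def inv_into_f_eq)
    then show ?thesis
      using bij[of "Suc k"] x by (simp add: bij_betw_def)
  qed
  then show ?thesis
    using linear_map_inv_into[OF lin bij] by (simp add: chain_map_def)
qed

lemma truncate_simps [simp]:
  "spc (cplx.truncate C) = spc C" "bd (cplx.truncate C) = bd C"
  by (simp_all add: cplx.defs)

lemma chain_map_truncate [simp]: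
  "chain_map K (cplx.truncate C) (cplx.truncate D) f \<longleftrightarrow> chain_map K C D f"
  by (simp add: chain_map_def)

text \<open>This makes the two sequences of simplifications stop at the same moment.\<close>

lemma zero_differential_iso:
  assumes bd: "\<And>j x. x \<in> carrier (spc C (Suc j)) \<Longrightarrow> bd C j x \<in> carrier (spc C j)"
    and "chain_iso K C C' f"
  shows "zero_differential C' \<longleftrightarrow> zero_differential C"
proof -
  have lin: "linear_map K (spc C j) (spc C' j) (f j)" for j
    using assms by (simp add: chain_iso_def chain_map_def)
  have ch: "f j (bd C j x) = bd C' j (f (Suc j) x)" if "x \<in> carrier (spc C (Suc j))" for x j
    using assms that by (simp add: chain_iso_def chain_map_def)
  have bij: "bij_betw (f j) (carrier (spc C j)) (carrier (spc C' j))" for j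
    using assms by (simp add: chain_iso_def)
  have cl: "x \<in> carrier (spc C (Suc j)) \<Longrightarrow> f (Suc j) x \<in> carrier (spc C' (Suc j))" for x j
    using bij[of "Suc j"] by (auto simp: bij_betw_def)
  have zero: "\<zero>\<^bsub>spc C j\<^esub> \<in> carrier (spc C j)" "f j \<zero>\<^bsub>spc C j\<^esub> = \<zero>\<^bsub>spc C' j\<^esub>" for j
  proof -
    interpret V: vectorspace K "spc C j" using lin by (rule linear_map.axioms)
    interpret linear_map K "spc C j" "spc C' j" "f j" by (rule lin)
    show "\<zero>\<^bsub>spc C j\<^esub> \<in> carrier (spc C j)" "f j \<zero>\<^bsub>spc C j\<^esub> = \<zero>\<^bsub>spc C' j\<^esub>" by simp_all
  qed
  show ?thesis
  proof
    assume Z: "zero_differential C'"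
    show "zero_differential C"
      unfolding zero_differential_def
    proof (intro allI ballI)
      fix j x assume x: "x \<in> carrier (spc C (Suc j))"
      then have "f j (bd C j x) = f j \<zero>\<^bsub>spc C j\<^esub>"
        using Z ch cl zero by (simp add: zero_differential_def)
      then show "bd C j x = \<zero>\<^bsub>spc C j\<^esub>"
        using bij[of j] zero(1) bd[OF x] unfolding bij_betw_def by (meson inj_onD)
    qed
  next
    assume Z: "zero_differential C"
    show "zero_differential C'"
      unfolding zero_differential_def
    proof (intro allI ballI)
      fix j y assume "y \<in> carrier (spc C' (Suc j))"
      then obtain x where "x \<in> carrier (spc C (Suc j))" "y = f (Suc j) x"
        using bij[of "Suc j"] by (auto simp: bij_betw_def)
      then show "bd C' j y = \<zero>\<^bsub>spc C' j\<^esub>"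
        using Z ch zero by (simp add: zero_differential_def flip: ch)
    qed
  qed
qed

section \<open>Complexes with indexed bases\<close>

definition based_complex :: "('f, 'm) ring_scheme \<Rightarrow> ('f, 'v, 'b) wbcplx \<Rightarrow> bool" where
  "based_complex K C \<longleftrightarrow>
     (\<forall>k. indexed_basis K (spc C k) (gens C k) (elt C k)) \<and>
     (\<forall>k. linear_map K (spc C (Suc k)) (spc C k) (bd C k)) \<and>
     (\<forall>k. \<forall>x\<in>carrier (spc C (Suc (Suc k))). bd C k (bd C (Suc k) x) = \<zero>\<^bsub>spc C k\<^esub>)"

lemma based_complex_bd_closed:
  assumes "based_complex K C" "x \<in> carrier (spc C (Suc j))"
  shows "bd C j x \<in> carrier (spc C j)"
proof -
  interpret linear_map K "spc C (Suc j)" "spc C j" "bd C j"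
    using assms by (simp add: based_complex_def)
  show ?thesis using assms by simp
qed

text \<open>A basis in the usual sense is a set of vectors. Injectivity of \<open>e\<close> moves
  coefficients between \<open>G\<close> and its image, and finite dimension makes \<open>G\<close>
  finite.\<close>

lemma indexed_basisI_basis:
  assumes V: "vectorspace K V" and fd: "vectorspace.fin_dim K V"
    and inj: "inj_on e G" and basis: "vectorspace.basis K V (e ` G)"
  shows "indexed_basis K V G e"
proof -
  interpret V: vectorspace K V by fact
  have eV: "e ` G \<subseteq> carrier V" using basis by (simp add: V.basis_def)
  then have e: "e \<in> G \<rightarrow> carrier V" by auto
  have finI: "finite (e ` G)" using basis fd by (auto simp: V.basis_def intro: V.fin_dim_li_fin)
  then have fin: "finite G" using inj finite_image_iff by blast
  have uniq: "\<exists>!c. c \<in> e ` G \<rightarrow>\<^sub>E carrier K \<and> V.lincomb c (e ` G) = x" if "x \<in> carrier V" for x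
    using V.basis_criterion[OF finI eV] basis that by blast
  have lc: "V.lincomb c (e ` G) = lcomb V G e (\<lambda>g. c (e g))" if "c \<in> e ` G \<rightarrow> carrier K" for c
  proof -
    have "(\<lambda>v. c v \<odot>\<^bsub>V\<^esub> v) \<in> e ` G \<rightarrow> carrier V" using that eV by auto
    then show ?thesis using inj by (simp add: V.lincomb_def lcomb_def V.M.finsum_reindex)
  qed
  have ex: "\<exists>c\<in>G \<rightarrow> carrier K. x = lcomb V G e c" if "x \<in> carrier V" for x
  proof -
    obtain c where c: "c \<in> e ` G \<rightarrow>\<^sub>E carrier K" "V.lincomb c (e ` G) = x" using uniq[OF \<open>x \<in> carrier V\<close>] by blast
    then have c': "c \<in> e ` G \<rightarrow> carrier K" by (auto simp: PiE_def)
    then show ?thesis using lc[OF c'] c(2) by (intro bexI[of _ "\<lambda>g. c (e g)"]) auto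
  qed
  have "c g = d g" if c: "c \<in> G \<rightarrow> carrier K" and d: "d \<in> G \<rightarrow> carrier K"
    and eq: "lcomb V G e c = lcomb V G e d" and g: "g \<in> G" for c d g
  proof -
    \<comment> \<open>Uniqueness is available among extensional functions on basis vectors, so
      coefficients on \<open>G\<close> are carried over to the image and restricted there.\<close>
    define ext where "ext c = restrict (\<lambda>v. c (inv_into G e v)) (e ` G)" for c :: "_ \<Rightarrow> 'a"
    have ext: "ext c (e g) = c g" if "g \<in> G" for c g using inj that by (simp add: ext_def)
    have extE: "ext c \<in> e ` G \<rightarrow>\<^sub>E carrier K" if "c \<in> G \<rightarrow> carrier K" for c
      using that by (auto simp: ext_def intro!: funcset_mem[OF that] inv_into_into)
    have "V.lincomb (ext c) (e ` G) = lcomb V G e c" if cK: "c \<in> G \<rightarrow> carrier K" for c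
    proof -
      have "ext c \<in> e ` G \<rightarrow> carrier K" using extE[OF cK] by (auto simp: PiE_def)
      then have "V.lincomb (ext c) (e ` G) = lcomb V G e (\<lambda>g. ext c (e g))" by (rule lc)
      also have "\<dots> = lcomb V G e c" using e cK by (intro V.lcomb_cong) (auto simp: ext)
      finally show ?thesis .
    qed
    then have "ext c = ext d"
      using uniq[OF V.lcomb_closed[OF e c]] extE[OF c] extE[OF d] c d eq by metis
    then show "c g = d g" using ext g by metis
  qed
  then show ?thesis using V e fin ex by (auto simp: indexed_basis_def)
qed

lemma based_complex_weighted: "weighted_based K C \<Longrightarrow> based_complex K C"
  by (auto simp: weighted_based_def compact_complex_def based_complex_def intro: indexed_basisI_basis)

section \<open>Simplification of a pair\<close>

lemma span_singleton:
  assumes "vectorspace K V" "u \<in> carrier V"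
  shows "LinearCombinations.module.span K V {u} = {s \<odot>\<^bsub>V\<^esub> u | s. s \<in> carrier K}"
proof -
  interpret V: vectorspace K V by fact
  have "V.lincomb a {u} = a u \<odot>\<^bsub>V\<^esub> u" if "a \<in> {u} \<rightarrow> carrier K" for a
    using assms(2) that unfolding V.lincomb_def by (subst V.M.finsum_insert) auto
  then have "V.span {u} = {a u \<odot>\<^bsub>V\<^esub> u | a. a \<in> {u} \<rightarrow> carrier K}"
    using assms(2) by (subst V.finite_span) (auto, metis+)
  also have "\<dots> = {s \<odot>\<^bsub>V\<^esub> u | s. s \<in> carrier K}"
    by (auto simp: Pi_iff)
  finally show ?thesis .
qed

locale simplification =
  fixes K :: "('f, 'm) ring_scheme" and C :: "('f, 'v, 'b) wbcplx" and k :: nat and a b :: 'b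
  assumes based: "based_complex K C"
    and a: "a \<in> gens C (Suc k)" and b: "b \<in> gens C k"
    and nz: "incidence K C (k, a, b) \<noteq> \<zero>\<^bsub>K\<^esub>"
begin

abbreviation "S \<equiv> simp_map K C (k, a, b)"
abbreviation "D \<equiv> simplify K C (k, a, b)"
abbreviation "u \<equiv> elt C (Suc k) a"

lemma vs: "vectorspace K (spc C j)"
  and basis: "indexed_basis K (spc C j) (gens C j) (elt C j)"
  and bd_linear: "linear_map K (spc C (Suc j)) (spc C j) (bd C j)"
  and bd_bd: "x \<in> carrier (spc C (Suc (Suc j))) \<Longrightarrow> bd C j (bd C (Suc j) x) = \<zero>\<^bsub>spc C j\<^esub>"
  using based by (auto simp: based_complex_def indexed_basis_def)

lemmas bd_closed = based_complex_bd_closed[OF based]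

lemma u_closed: "u \<in> carrier (spc C (Suc k))"
  using basis[of "Suc k"] a by (auto simp: indexed_basis_def)

lemma bd_u_closed: "bd C k u \<in> carrier (spc C k)"
  by (rule bd_closed[OF u_closed])

lemma quotient_space_simp_sub:
  assumes "j = Suc k \<or> j = k" shows "quotient_space K (spc C j) (simp_sub K C (k, a, b) j)"
proof -
  interpret vectorspace K "spc C j" by (rule vs)
  show ?thesis
    using assms u_closed bd_u_closed span_is_subspace
    by (auto simp: quotient_space_def simp_sub_def)
qed

text \<open>Away from the two affected degrees the identity is a retraction as well, so descent can
  be applied in all degrees alike.\<close>

lemma retraction_S: "retraction K (spc C j) (spc D j) (S j)"
proof (cases "j = Suc k \<or> j = k")
  case True
  then interpret quotient_space K "spc C j" "simp_sub K C (k, a, b) j"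
    by (rule quotient_space_simp_sub)
  show ?thesis using True retraction_q by (simp add: simplify_def simp_map_def)
next
  case False
  then show ?thesis by (simp add: simplify_def simp_map_def retraction_id vs)
qed

text \<open>The kernel of the quotient map, as a set that an isomorphism of based complexes visibly
  preserves.\<close>

definition killed :: "nat \<Rightarrow> 'v set" where
  "killed j =
     (if j = Suc k then {s \<odot>\<^bsub>spc C j\<^esub> u | s. s \<in> carrier K}
      else if j = k then {s \<odot>\<^bsub>spc C j\<^esub> bd C k u | s. s \<in> carrier K}
      else {\<zero>\<^bsub>spc C j\<^esub>})"

lemma S_eq_zero_iff: "x \<in> carrier (spc C j) \<Longrightarrow> S j x = \<zero>\<^bsub>spc D j\<^esub> \<longleftrightarrow> x \<in> killed j"
proof (cases "j = Suc k \<or> j = k")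
  case True
  then interpret quotient_space K "spc C j" "simp_sub K C (k, a, b) j"
    by (rule quotient_space_simp_sub)
  have *: "simp_sub K C (k, a, b) j = killed j"
    using True span_singleton[OF vs u_closed] span_singleton[OF vs bd_u_closed]
    by (auto simp: simp_sub_def killed_def)
  assume "x \<in> carrier (spc C j)"
  then show ?thesis using True q_eq_zero_iff[of x] unfolding * by (simp add: simplify_def simp_map_def *)
next
  case False
  then show ?thesis by (simp add: simplify_def simp_map_def killed_def)
qed

lemma S_linear: "linear_map K (spc C j) (spc D j) (S j)"
  using retraction_S by (simp add: retraction_def)

lemma S_surj: "S j ` carrier (spc C j) = carrier (spc D j)"
proof -
  interpret linear_map K "spc C j" "spc D j" "S j" by (rule S_linear)
  have "x \<in> S j ` carrier (spc C j)" if "x \<in> carrier (spc D j)" for x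
    using retraction_S[of j] that unfolding retraction_def by (metis image_eqI subsetD)
  then show ?thesis by auto
qed

lemma zero_killed: "\<zero>\<^bsub>spc C j\<^esub> \<in> killed j"
proof -
  interpret vectorspace K "spc C j" by (rule vs)
  have "\<exists>s. \<zero>\<^bsub>spc C j\<^esub> = s \<odot>\<^bsub>spc C j\<^esub> x \<and> s \<in> carrier K" if "x \<in> carrier (spc C j)" for x
    using that by (intro exI[of _ "\<zero>\<^bsub>K\<^esub>"]) simp
  from this[of u] this[of "bd C k u"] show ?thesis
    using u_closed bd_u_closed by (cases "j = Suc k"; cases "j = k") (simp_all add: killed_def)
qed

text \<open>The killed spaces form a subcomplex: the line of \<open>u\<close> goes to the line of
  its boundary, which goes to zero since the boundary squares to zero. This is what lets the
  differential descend.\<close>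

lemma bd_killed: "x \<in> killed (Suc j) \<Longrightarrow> bd C j x \<in> killed j"
proof -
  assume x: "x \<in> killed (Suc j)"
  interpret linear_map K "spc C (Suc j)" "spc C j" "bd C j" by (rule bd_linear)
  consider "j = k" | "Suc j = k" | "j \<noteq> k" "Suc j \<noteq> k" by blast
  then show ?thesis
  proof cases
    case 1
    then obtain s where s: "s \<in> carrier K" "x = s \<odot>\<^bsub>spc C (Suc j)\<^esub> u"
      using x by (auto simp: killed_def)
    moreover have "u \<in> carrier (spc C (Suc j))" using 1 u_closed by simp
    ultimately have "bd C j x = s \<odot>\<^bsub>spc C j\<^esub> bd C j u" by simp
    then show ?thesis using 1 s by (auto simp: killed_def)
  next
    case 2
    then obtain s where s: "s \<in> carrier K" "x = s \<odot>\<^bsub>spc C (Suc j)\<^esub> bd C (Suc j) u"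
      using x by (auto simp: killed_def)
    moreover have "bd C (Suc j) u \<in> carrier (spc C (Suc j))" using 2 bd_u_closed by simp
    ultimately have "bd C j x = s \<odot>\<^bsub>spc C j\<^esub> bd C j (bd C (Suc j) u)" by simp
    also have "bd C j (bd C (Suc j) u) = \<zero>\<^bsub>spc C j\<^esub>" using 2 u_closed bd_bd[of u j] by auto
    also have "s \<odot>\<^bsub>spc C j\<^esub> \<zero>\<^bsub>spc C j\<^esub> = \<zero>\<^bsub>spc C j\<^esub>"
      using s by simp
    finally show ?thesis using 2 by (auto simp: killed_def)
  next
    case 3
    then have "bd C j x = \<zero>\<^bsub>spc C j\<^esub>" using x by (simp add: killed_def)
    then show ?thesis using zero_killed by simp
  qed
qed

lemma bd_D: "bd D j x = S j (bd C j x)"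
  by (simp add: simplify_def)

lemma S_bd_linear: "linear_map K (spc C (Suc j)) (spc D j) (\<lambda>x. S j (bd C j x))"
  by (rule linear_map_comp[OF bd_linear S_linear])

lemma S_bd_killed:
  assumes "x \<in> carrier (spc C (Suc j))" "S (Suc j) x = \<zero>\<^bsub>spc D (Suc j)\<^esub>"
  shows "S j (bd C j x) = \<zero>\<^bsub>spc D j\<^esub>"
  using assms bd_killed S_eq_zero_iff bd_closed by auto

text \<open>Representatives are vectors of \<open>C\<close>, so the differential of \<open>D\<close>
  is \<open>bd C j\<close> followed by \<open>S j\<close>; what needs proof is that it does not see
  the choice of representative.\<close>

lemma S_chain: "x \<in> carrier (spc C (Suc j)) \<Longrightarrow> bd D j (S (Suc j) x) = S j (bd C j x)"
  unfolding bd_D by (rule retraction_descend(1)[OF retraction_S S_bd_linear S_bd_killed])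

lemma chain_map_S: "chain_map K C D S"
  by (simp add: chain_map_def S_linear S_chain)

lemma carrier_D_subset: "carrier (spc D j) \<subseteq> carrier (spc C j)"
  using retraction_S by (simp add: retraction_def)

lemma basis_D: "indexed_basis K (spc D j) (gens D j) (elt D j)"
proof -
  have elt: "elt D j = (\<lambda>g. S j (elt C j g))" by (simp add: simplify_def)
  consider "j = Suc k" | "j = k" | "j \<noteq> k" "j \<noteq> Suc k" by blast
  then show ?thesis
  proof cases
    \<comment> \<open>Here the quotient is by \<open>u\<close> itself, whose coefficient at
      \<open>a\<close> is one.\<close>
    case 1
    have "\<one>\<^bsub>K\<^esub> \<noteq> \<zero>\<^bsub>K\<^esub>"
    proof - interpret vectorspace K "spc C 0" by (rule vs) show ?thesis by simp qed
    then have "indexed_basis K (spc D j) (gens C j - {a}) (\<lambda>g. S j (elt C j g))"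
      using 1 a S_eq_zero_iff[of _ j] coords_basis_vector[OF basis a]
      by (intro indexed_basis_quotient[OF basis S_linear S_surj, of "elt C j a"])
         (auto simp: killed_def intro: u_closed)
    then show ?thesis unfolding elt using 1 by (simp add: simplify_def)
  next
    \<comment> \<open>Here the quotient is by the boundary of \<open>u\<close>, whose coefficient at
      \<open>b\<close> is the non-zero incidence.\<close>
    case 2
    have "indexed_basis K (spc D j) (gens C j - {b}) (\<lambda>g. S j (elt C j g))"
      using 2 b S_eq_zero_iff[of _ j] nz
      by (intro indexed_basis_quotient[OF basis S_linear S_surj, of "bd C k u"])
         (auto simp: killed_def incidence_def coord_eq_coords intro: bd_u_closed)
    then show ?thesis unfolding elt using 2 by (simp add: simplify_def)
  next
    case 3
    then show ?thesis using basis[of j] by (simp add: simplify_def simp_map_def)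
  qed
qed

lemma based_D: "based_complex K D"
  unfolding based_complex_def
proof (intro conjI allI ballI)
  fix j show "indexed_basis K (spc D j) (gens D j) (elt D j)" by (rule basis_D)
  have "linear_map K (spc D (Suc j)) (spc D j) (\<lambda>x. S j (bd C j x))"
    by (rule retraction_descend(2)[OF retraction_S S_bd_linear S_bd_killed])
  then show "linear_map K (spc D (Suc j)) (spc D j) (bd D j)" by (simp add: simplify_def)
  fix x assume "x \<in> carrier (spc D (Suc (Suc j)))"
  then have x: "x \<in> carrier (spc C (Suc (Suc j)))" using carrier_D_subset by blast
  have "bd D j (bd D (Suc j) x) = S j (bd C j (bd C (Suc j) x))"
    unfolding bd_D[of "Suc j"] using x by (intro S_chain bd_closed)
  also have "\<dots> = \<zero>\<^bsub>spc D j\<^esub>"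
  proof -
    interpret linear_map K "spc C j" "spc D j" "S j" by (rule S_linear)
    show ?thesis using x by (simp add: bd_bd)
  qed
  finally show "bd D j (bd D (Suc j) x) = \<zero>\<^bsub>spc D j\<^esub>" .
qed

end

section \<open>Isomorphisms of based complexes\<close>

definition based_iso ::
  "('f, 'm) ring_scheme \<Rightarrow> ('f, 'v, 'b) wbcplx \<Rightarrow> ('f, 'w, 'c) wbcplx
    \<Rightarrow> (nat \<Rightarrow> 'b \<Rightarrow> 'c) \<Rightarrow> (nat \<Rightarrow> 'v \<Rightarrow> 'w) \<Rightarrow> bool" where
  "based_iso K C C' \<phi> f \<longleftrightarrow>
     based_complex K C \<and> based_complex K C' \<and>
     (\<forall>k. bij_betw (\<phi> k) (gens C k) (gens C' k)) \<and>
     chain_iso K C C' f \<and> (\<forall>k. \<forall>b\<in>gens C k. f k (elt C k b) = elt C' k (\<phi> k b))"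

text \<open>Lets results about two isomorphic complexes be applied to a single one.\<close>

lemma based_iso_refl: "based_complex K C \<Longrightarrow> based_iso K C C (\<lambda>k b. b) (\<lambda>k x. x)"
  by (auto simp: based_iso_def chain_iso_def chain_map_def based_complex_def indexed_basis_def
      bij_betw_def intro: linear_map_id)

lemma based_iso_incidence:
  assumes iso: "based_iso K C C' \<phi> f" and p: "p \<in> basis_pairs C"
  shows "incidence K C' (pair_map \<phi> p) = incidence K C p"
proof -
  obtain k a b where p_eq: "p = (k, a, b)" and a: "a \<in> gens C (Suc k)" and b: "b \<in> gens C k"
    using p by (auto simp: basis_pairs_def)
  have B: "indexed_basis K (spc C j) (gens C j) (elt C j)" for j
    using iso by (simp add: based_iso_def based_complex_def)
  have B': "indexed_basis K (spc C' j) (gens C' j) (elt C' j)" for j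
    using iso by (simp add: based_iso_def based_complex_def)
  have ea: "elt C (Suc k) a \<in> carrier (spc C (Suc k))"
    using B[of "Suc k"] a by (auto simp: indexed_basis_def)
  interpret d: linear_map K "spc C (Suc k)" "spc C k" "bd C k"
    using iso by (simp add: based_iso_def based_complex_def)
  have "bd C' k (elt C' (Suc k) (\<phi> (Suc k) a)) = bd C' k (f (Suc k) (elt C (Suc k) a))"
    using iso a by (simp add: based_iso_def)
  also have "\<dots> = f k (bd C k (elt C (Suc k) a))"
    using iso ea by (simp add: based_iso_def chain_iso_def chain_map_def)
  finally have "incidence K C' (pair_map \<phi> p)
      = coords K (spc C' k) (gens C' k) (elt C' k) (f k (bd C k (elt C (Suc k) a))) (\<phi> k b)"
    by (simp add: p_eq pair_map_def incidence_def coord_eq_coords)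
  also have "\<dots> = coords K (spc C k) (gens C k) (elt C k) (bd C k (elt C (Suc k) a)) b"
    using iso ea b by (intro coords_iso[OF B B']) (auto simp: based_iso_def chain_iso_def chain_map_def)
  also have "\<dots> = incidence K C p" by (simp add: p_eq incidence_def coord_eq_coords)
  finally show ?thesis .
qed

text \<open>\<open>f\<close> matches the kernels of the two quotient maps, so \<open>f\<close> and
  its inverse both descend; the quotient map of the target is appended to reach chosen
  representatives again. The second claim is the compatibility of the old and new isomorphisms with
  the quotient maps.\<close>

lemma based_iso_simplify:
  assumes iso: "based_iso K C C' \<phi> f" and p: "p \<in> basis_pairs C" and nz: "incidence K C p \<noteq> \<zero>\<^bsub>K\<^esub>"
  defines "p' \<equiv> pair_map \<phi> p"
  shows "based_iso K (simplify K C p) (simplify K C' p') \<phi> (\<lambda>j x. simp_map K C' p' j (f j x))"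
    and "x \<in> carrier (spc C j) \<Longrightarrow> simp_map K C' p' j (f j (simp_map K C p j x)) = simp_map K C' p' j (f j x)"
proof -
  obtain k a b where p_eq: "p = (k, a, b)" and a: "a \<in> gens C (Suc k)" and b: "b \<in> gens C k"
    using p by (auto simp: basis_pairs_def)
  have p'_eq: "p' = (k, \<phi> (Suc k) a, \<phi> k b)" by (simp add: p'_def p_eq pair_map_def)
  have \<phi>: "bij_betw (\<phi> j) (gens C j) (gens C' j)" for j using iso by (simp add: based_iso_def)
  interpret A: simplification K C k a b
    using iso a b nz by (simp add: simplification_def based_iso_def p_eq)
  interpret B: simplification K C' k "\<phi> (Suc k) a" "\<phi> k b"
    using iso a b nz \<phi> based_iso_incidence[OF iso p]
    by (auto simp: simplification_def based_iso_def p_eq pair_map_def bij_betw_def)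
  have f_lin: "linear_map K (spc C j) (spc C' j) (f j)" and f_bij: "bij_betw (f j) (carrier (spc C j)) (carrier (spc C' j))"
    and f_bd: "y \<in> carrier (spc C (Suc j)) \<Longrightarrow> f j (bd C j y) = bd C' j (f (Suc j) y)"
    and f_elt: "g \<in> gens C j \<Longrightarrow> f j (elt C j g) = elt C' j (\<phi> j g)" for j y g
    using iso by (simp_all add: based_iso_def chain_iso_def chain_map_def)
  have f_closed: "y \<in> carrier (spc C j) \<Longrightarrow> f j y \<in> carrier (spc C' j)" for j y
    using f_bij[of j] by (auto simp: bij_betw_def)
  have f_smult: "s \<in> carrier K \<Longrightarrow> y \<in> carrier (spc C j) \<Longrightarrow> f j (s \<odot>\<^bsub>spc C j\<^esub> y) = s \<odot>\<^bsub>spc C' j\<^esub> f j y" for j s y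
  proof -
    interpret linear_map K "spc C j" "spc C' j" "f j" by (rule f_lin)
    show "s \<in> carrier K \<Longrightarrow> y \<in> carrier (spc C j) \<Longrightarrow> ?thesis" by simp
  qed
  have f_zero: "f j \<zero>\<^bsub>spc C j\<^esub> = \<zero>\<^bsub>spc C' j\<^esub>" for j
  proof -
    interpret linear_map K "spc C j" "spc C' j" "f j" by (rule f_lin)
    show ?thesis by simp
  qed
  define g where "g j = inv_into (carrier (spc C j)) (f j)" for j
  have g_lin: "linear_map K (spc C' j) (spc C j) (g j)" for j
    unfolding g_def by (rule linear_map_inv_into[OF f_lin f_bij])
  have gf: "y \<in> carrier (spc C j) \<Longrightarrow> g j (f j y) = y" for j y
    using f_bij[of j] by (simp add: g_def bij_betw_def)
  have fg: "y \<in> carrier (spc C' j) \<Longrightarrow> f j (g j y) = y"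
    and g_closed: "y \<in> carrier (spc C' j) \<Longrightarrow> g j y \<in> carrier (spc C j)" for j y
    using f_bij[of j] by (auto simp: g_def bij_betw_def f_inv_into_f inv_into_into)
  have killed_sub: "A.killed j \<subseteq> carrier (spc C j)" for j
  proof -
    interpret vectorspace K "spc C j" by (rule A.vs)
    show ?thesis using A.u_closed A.bd_u_closed smult_closed
      by (cases "j = Suc k"; cases "j = k") (auto simp: A.killed_def)
  qed
  \<comment> \<open>\<open>f\<close> sends the vector of \<open>a\<close> to that of its partner and
    commutes with boundaries and scalars, so spanning vectors correspond.\<close>
  have killed: "B.killed j = f j ` A.killed j" for j
    using f_elt[OF a] f_bd[OF A.u_closed] f_zero[of j] f_smult[OF _ A.u_closed] f_smult[OF _ A.bd_u_closed]
    by (auto simp: A.killed_def B.killed_def image_iff) (metis+)?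
  have S'f_lin: "linear_map K (spc C j) (spc B.D j) (\<lambda>x. B.S j (f j x))" for j
    by (rule linear_map_comp[OF f_lin B.S_linear])
  have S'f_ker: "B.S j (f j y) = \<zero>\<^bsub>spc B.D j\<^esub>"
    if "y \<in> carrier (spc C j)" "A.S j y = \<zero>\<^bsub>spc A.D j\<^esub>" for j y
    using that by (simp add: A.S_eq_zero_iff B.S_eq_zero_iff f_closed killed)
  have F1: "B.S j (f j (A.S j y)) = B.S j (f j y)" if "y \<in> carrier (spc C j)" for j y
    by (rule retraction_descend(1)[OF A.retraction_S S'f_lin S'f_ker that])
  have F2: "linear_map K (spc A.D j) (spc B.D j) (\<lambda>x. B.S j (f j x))" for j
    by (rule retraction_descend(2)[OF A.retraction_S S'f_lin S'f_ker])
  have Sg_lin: "linear_map K (spc C' j) (spc A.D j) (\<lambda>x. A.S j (g j x))" for j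
    by (rule linear_map_comp[OF g_lin A.S_linear])
  have Sg_ker: "A.S j (g j y) = \<zero>\<^bsub>spc A.D j\<^esub>"
    if "y \<in> carrier (spc C' j)" "B.S j y = \<zero>\<^bsub>spc B.D j\<^esub>" for j y
  proof -
    have "y \<in> f j ` A.killed j" using that by (simp add: B.S_eq_zero_iff killed)
    then obtain x where "x \<in> A.killed j" "y = f j x" by blast
    then have "g j y \<in> A.killed j" using gf[of x j] killed_sub[of j] by auto
    then show ?thesis using that g_closed by (simp add: A.S_eq_zero_iff)
  qed
  have G1: "A.S j (g j (B.S j y)) = A.S j (g j y)" if "y \<in> carrier (spc C' j)" for j y
    by (rule retraction_descend(1)[OF B.retraction_S Sg_lin Sg_ker that])
  show "x \<in> carrier (spc C j) \<Longrightarrow> simp_map K C' p' j (f j (simp_map K C p j x)) = simp_map K C' p' j (f j x)"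
    unfolding p_eq p'_eq by (rule F1)
  have D_id: "y \<in> carrier (spc A.D j) \<Longrightarrow> A.S j y = y" "z \<in> carrier (spc B.D j) \<Longrightarrow> B.S j z = z" for j y z
    using A.retraction_S B.retraction_S by (auto simp: retraction_def)
  have sub: "y \<in> carrier (spc A.D j) \<Longrightarrow> y \<in> carrier (spc C j)"
    "z \<in> carrier (spc B.D j) \<Longrightarrow> z \<in> carrier (spc C' j)" for j y z
    using A.carrier_D_subset B.carrier_D_subset by auto
  \<comment> \<open>In both composites \<open>F1\<close> and \<open>G1\<close> remove the inner
    quotient map, then \<open>f\<close> and \<open>g\<close> cancel, and the remaining quotient map
    fixes representatives.\<close>
  have bij: "bij_betw (\<lambda>x. B.S j (f j x)) (carrier (spc A.D j)) (carrier (spc B.D j))" for j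
  proof (rule bij_betw_byWitness[where f' = "\<lambda>x. A.S j (g j x)"])
    show "\<forall>y\<in>carrier (spc A.D j). A.S j (g j (B.S j (f j y))) = y"
      using G1 sub f_closed gf D_id by simp
    show "\<forall>y\<in>carrier (spc B.D j). B.S j (f j (A.S j (g j y))) = y"
      using F1 sub g_closed fg D_id by simp
    show "(\<lambda>x. B.S j (f j x)) ` carrier (spc A.D j) \<subseteq> carrier (spc B.D j)"
      using sub f_closed B.S_surj by blast
    show "(\<lambda>x. A.S j (g j x)) ` carrier (spc B.D j) \<subseteq> carrier (spc A.D j)"
      using sub g_closed A.S_surj by blast
  qed
  have chain: "B.S j (f j (bd A.D j y)) = bd B.D j (B.S (Suc j) (f (Suc j) y))"
    if y: "y \<in> carrier (spc A.D (Suc j))" for j y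
  proof -
    have "B.S j (f j (bd A.D j y)) = B.S j (f j (bd C j y))"
      unfolding A.bd_D using y sub A.bd_closed by (intro F1) auto
    also have "\<dots> = B.S j (bd C' j (f (Suc j) y))" using y sub f_bd by simp
    also have "\<dots> = bd B.D j (B.S (Suc j) (f (Suc j) y))"
      using y sub f_closed B.S_chain by simp
    finally show ?thesis .
  qed
  have gens: "bij_betw (\<phi> j) (gens A.D j) (gens B.D j)" for j
  proof -
    have "bij_betw (\<phi> j) (gens C j - {c}) (gens C' j - {\<phi> j c})" if "c \<in> gens C j" for c j
      using \<phi>[of j] that by (auto simp: bij_betw_def inj_on_def)
    then show ?thesis using \<phi> a b by (simp add: simplify_def)
  qed
  have elts: "B.S j (f j (elt A.D j g)) = elt B.D j (\<phi> j g)" if "g \<in> gens A.D j" for j g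
  proof -
    have g: "g \<in> gens C j" using that by (auto simp: simplify_def split: if_splits)
    then have "elt C j g \<in> carrier (spc C j)" using A.basis[of j] by (auto simp: indexed_basis_def)
    then have "B.S j (f j (A.S j (elt C j g))) = B.S j (f j (elt C j g))" by (rule F1)
    then show ?thesis using g by (simp add: simplify_def f_elt)
  qed
  show "based_iso K (simplify K C p) (simplify K C' p') \<phi> (\<lambda>j x. simp_map K C' p' j (f j x))"
    unfolding based_iso_def chain_iso_def chain_map_def p_eq p'_eq
    using A.based_D B.based_D F2 bij chain gens elts by simp
qed

section \<open>Sequences of simplified pairs\<close>

text \<open>Weights are inherited and pairs only disappear, so the assumed ordering of the weights
  persists through all stages.\<close>

lemma simplify_simps [simp]:
  "pair_weight (simplify K C p) = pair_weight C"
  "basis_pairs (simplify K C p) \<subseteq> basis_pairs C"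
  by (auto simp: simplify_def pair_weight_def basis_pairs_def fun_eq_iff split: prod.splits if_splits)

text \<open>Minimality in \<open>C'\<close> competes with every pair of \<open>C'\<close>, so each
  of them must be known to come from \<open>C\<close>.\<close>

lemma basis_pairs_image:
  assumes "\<And>k. bij_betw (\<phi> k) (gens C k) (gens C' k)"
  shows "basis_pairs C' = pair_map \<phi> ` basis_pairs C"
proof
  show "basis_pairs C' \<subseteq> pair_map \<phi> ` basis_pairs C"
  proof
    fix p assume "p \<in> basis_pairs C'"
    then obtain k a b where p: "p = (k, a, b)" "a \<in> gens C' (Suc k)" "b \<in> gens C' k"
      by (auto simp: basis_pairs_def)
    then obtain c d where "a = \<phi> (Suc k) c" "c \<in> gens C (Suc k)" "b = \<phi> k d" "d \<in> gens C k"
      using assms[of k] assms[of "Suc k"] unfolding bij_betw_def by blast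
    then show "p \<in> pair_map \<phi> ` basis_pairs C"
      using p by (intro image_eqI[of _ _ "(k, c, d)"]) (auto simp: basis_pairs_def pair_map_def)
  qed
  show "pair_map \<phi> ` basis_pairs C \<subseteq> basis_pairs C'"
    using assms by (auto simp: basis_pairs_def pair_map_def bij_betw_def)
qed

text \<open>Candidate pairs and their incidence coefficients correspond, so preserving the weak
  order is enough to carry the minimum over.\<close>

lemma minimal_pair_iso:
  assumes iso: "based_iso K C C' \<phi> f" and min: "minimal_pair K C p"
    and wt: "\<And>p q. p \<in> basis_pairs C \<Longrightarrow> q \<in> basis_pairs C \<Longrightarrow> pair_weight C p \<le> pair_weight C q \<Longrightarrow>
      pair_weight C' (pair_map \<phi> p) \<le> pair_weight C' (pair_map \<phi> q)"
  shows "minimal_pair K C' (pair_map \<phi> p)"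
proof -
  have \<phi>: "basis_pairs C' = pair_map \<phi> ` basis_pairs C"
    using iso by (intro basis_pairs_image) (simp add: based_iso_def)
  show ?thesis
    using min based_iso_incidence[OF iso] wt by (auto simp: minimal_pair_def \<phi>)
qed

lemma simplified_pairs_iso:
  assumes "based_iso K C C' \<phi> f" and "simplified_pairs K C ps"
    and "\<And>p q. p \<in> basis_pairs C \<Longrightarrow> q \<in> basis_pairs C \<Longrightarrow> pair_weight C p \<le> pair_weight C q \<Longrightarrow>
      pair_weight C' (pair_map \<phi> p) \<le> pair_weight C' (pair_map \<phi> q)"
  shows "simplified_pairs K C' (map (pair_map \<phi>) ps)"
  using assms
\<comment> \<open>The complexes and the isomorphism change at every step, while
  \<open>\<phi>\<close> stays fixed because classes keep their indices.\<close>
proof (induction ps arbitrary: C C' f)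
  case Nil
  then show ?case
    using zero_differential_iso[of C K C' f] based_complex_bd_closed[of K C] by (auto simp: based_iso_def)
next
  case (Cons p ps)
  have zd: "\<not> zero_differential C'"
    using Cons.prems zero_differential_iso[of C K C' f] based_complex_bd_closed[of K C]
    by (auto simp: based_iso_def)
  have min: "minimal_pair K C p" using Cons.prems by simp
  then have p: "p \<in> basis_pairs C" "incidence K C p \<noteq> \<zero>\<^bsub>K\<^esub>" by (simp_all add: minimal_pair_def)
  have "simplified_pairs K (simplify K C' (pair_map \<phi> p)) (map (pair_map \<phi>) ps)"
    using Cons.prems simplify_simps(2)[of K C p]
    by (intro Cons.IH[OF based_iso_simplify(1)[OF Cons.prems(1) p]]) (auto simp: subset_iff)
  then show ?case using zd minimal_pair_iso[OF Cons.prems(1) min Cons.prems(3)] by simp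
qed

section \<open>Stages of the simplification sequence and their isomorphisms\<close>

lemma stage_Suc: "i < length ps \<Longrightarrow> stage K C ps (Suc i) = simplify K (stage K C ps i) (ps ! i)"
  by (simp add: stage_def take_Suc_conv_app_nth)

lemma stage_0 [simp]: "stage K C ps 0 = C"
  by (simp add: stage_def)

lemma minimal_pair_stage:
  "simplified_pairs K C ps \<Longrightarrow> i < length ps \<Longrightarrow> minimal_pair K (stage K C ps i) (ps ! i)"
proof (induction ps arbitrary: C i)
  case (Cons p ps)
  then show ?case by (cases i) (auto simp: stage_def)
qed simp

lemma stage_basis_pairs: "i \<le> length ps \<Longrightarrow> basis_pairs (stage K C ps i) \<subseteq> basis_pairs C"
proof (induction i)
  case (Suc i)
  then show ?case
    by (simp add: stage_Suc subset_trans[OF simplify_simps(2)])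
qed simp

lemma simplified_pairs_basis_pairs:
  assumes "simplified_pairs K C ps" "i < length ps"
  shows "ps ! i \<in> basis_pairs C"
  using minimal_pair_stage[OF assms] stage_basis_pairs[of i ps K C] assms(2)
  by (auto simp: minimal_pair_def)

text \<open>Functoriality of the quotient maps in the stage index, needed for the internal maps of
  X.\<close>

lemma stage_map_add:
  "stage_map K C ps i (l + m) k x = stage_map K C ps (i + l) m k (stage_map K C ps i l k x)"
  by (induction m) (simp_all add: add.assoc)

locale simplified_iso =
  fixes K :: "('f, 'm) ring_scheme" and C :: "('f, 'v, 'b) wbcplx" and C' :: "('f, 'w, 'c) wbcplx"
    and \<phi> :: "nat \<Rightarrow> 'b \<Rightarrow> 'c" and f :: "nat \<Rightarrow> 'v \<Rightarrow> 'w" and ps :: "(nat \<times> 'b \<times> 'b) list"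
  assumes iso: "based_iso K C C' \<phi> f"
    and simplified: "simplified_pairs K C ps"
begin

abbreviation "ps' \<equiv> map (pair_map \<phi>) ps"

text \<open>A stage is carried by a subset of the original complex, so the isomorphism between the
  \<open>i\<close>-th stages is the original isomorphism followed by the quotient maps of the target.\<close>

definition stage_iso :: "nat \<Rightarrow> nat \<Rightarrow> 'v \<Rightarrow> 'w" where
  "stage_iso i k x = stage_map K C' ps' 0 i k (f k x)"

lemma based_iso_stage:
  "i \<le> length ps \<Longrightarrow> based_iso K (stage K C ps i) (stage K C' ps' i) \<phi> (stage_iso i)"
proof (induction i)
  case 0 then show ?case using iso by (simp add: stage_iso_def)
next
  case (Suc i)
  have "stage_iso (Suc i) = (\<lambda>k x. simp_map K (stage K C' ps' i) (pair_map \<phi> (ps ! i)) k (stage_iso i k x))"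
    using Suc.prems by (simp add: stage_iso_def fun_eq_iff)
  then show ?case
    using Suc minimal_pair_stage[OF simplified, of i]
      based_iso_simplify(1)[of K "stage K C ps i" "stage K C' ps' i" \<phi> "stage_iso i" "ps ! i"]
    by (simp add: stage_Suc minimal_pair_def)
qed

text \<open>The new stage isomorphism ends with the target quotient map, so applying the source
  quotient map beforehand makes no difference; this is the second claim of
  \<open>based_iso_simplify\<close>.\<close>

lemma stage_iso_simp_map:
  assumes "i < length ps" "x \<in> carrier (spc (stage K C ps i) k)"
  shows "stage_iso (Suc i) k (simp_map K (stage K C ps i) (ps ! i) k x)
    = simp_map K (stage K C' ps' i) (ps' ! i) k (stage_iso i k x)"
  using assms minimal_pair_stage[OF simplified, of i] based_iso_stage[of i]
    based_iso_simplify(2)[of K "stage K C ps i" "stage K C' ps' i" \<phi> "stage_iso i" "ps ! i" x k]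
  by (simp add: stage_iso_def minimal_pair_def)

lemma chain_map_simp_map:
  assumes "i < length ps"
  shows "chain_map K (stage K C ps i) (stage K C ps (Suc i)) (simp_map K (stage K C ps i) (ps ! i))"
proof -
  obtain k a b where p: "ps ! i = (k, a, b)" by (cases "ps ! i")
  interpret simplification K "stage K C ps i" k a b
    using assms minimal_pair_stage[OF simplified assms] based_iso_stage[of i]
    by (auto simp: simplification_def minimal_pair_def based_iso_def basis_pairs_def p)
  show ?thesis using chain_map_S assms by (simp add: stage_Suc p)
qed

lemma chain_map_stage_map:
  "i + m \<le> length ps \<Longrightarrow> chain_map K (stage K C ps i) (stage K C ps (i + m)) (stage_map K C ps i m)"
proof (induction m)
  case 0
  have "based_complex K (stage K C ps i)" using 0 based_iso_stage[of i] by (simp add: based_iso_def)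
  then show ?case by (auto simp: chain_map_def based_complex_def indexed_basis_def intro: linear_map_id)
next
  case (Suc m)
  then show ?case using chain_map_comp[OF Suc.IH chain_map_simp_map[of "i + m"]] by simp
qed

lemma stage_map_closed:
  assumes "i + m \<le> length ps" "x \<in> carrier (spc (stage K C ps i) k)"
  shows "stage_map K C ps i m k x \<in> carrier (spc (stage K C ps (i + m)) k)"
proof -
  interpret linear_map K "spc (stage K C ps i) k" "spc (stage K C ps (i + m)) k" "stage_map K C ps i m k"
    using chain_map_stage_map[OF assms(1)] by (simp add: chain_map_def)
  show ?thesis using assms by simp
qed

lemma stage_iso_stage_map:
  assumes "i + m \<le> length ps" "x \<in> carrier (spc (stage K C ps i) k)"
  shows "stage_iso (i + m) k (stage_map K C ps i m k x) = stage_map K C' ps' i m k (stage_iso i k x)"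
  using assms
proof (induction m)
  case (Suc m)
  then show ?case using stage_iso_simp_map[of "i + m", OF _ stage_map_closed] by simp
qed simp

end

section \<open>Interleavings of the construction X\<close>

text \<open>The infimum ranges over positive epsilon, while \<open>e\<close> may be zero or not
  realised. Bounding by \<open>e + d\<close> for every positive \<open>d\<close> avoids both
  questions.\<close>

lemma interleaving_dist_le:
  assumes "\<And>\<epsilon>. 0 < \<epsilon> \<Longrightarrow> e < \<epsilon> \<Longrightarrow> \<exists>\<phi> \<psi>. interleaving K \<epsilon> X Y \<phi> \<psi>" and "0 \<le> e"
  shows "interleaving_dist K X Y \<le> ereal e"
proof (rule ereal_le_epsilon2)
  fix d :: real assume "0 < d"
  then have "interleaving_dist K X Y \<le> ereal (e + d)"
    unfolding interleaving_dist_def using assms(1)[of "e + d"] assms(2) by (intro Inf_lower) auto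
  then show "interleaving_dist K X Y \<le> ereal e + ereal d" by simp
qed

text \<open>Both functors run along one finite chain of stages at different speeds
  \<open>\<sigma>\<close> and \<open>\<sigma>'\<close>. An interleaving map changes sides at the
  current stage and then moves forward, which is possible as
  \<open>\<sigma> t \<le> \<sigma>' (t + \<epsilon>)\<close>. In a round trip the isomorphisms
  cancel and only forward motion remains.\<close>

lemma step_interleaving:
  fixes D :: "nat \<Rightarrow> ('f, 'v) cplx" and D' :: "nat \<Rightarrow> ('f, 'w) cplx" and \<sigma> \<sigma>' :: "real \<Rightarrow> nat"
  assumes f: "\<And>i. i \<le> n \<Longrightarrow> chain_map K (D i) (D' i) (f i)"
    and g: "\<And>i. i \<le> n \<Longrightarrow> chain_map K (D' i) (D i) (g i)"
    and gf: "\<And>i k x. i \<le> n \<Longrightarrow> x \<in> carrier (spc (D i) k) \<Longrightarrow> g i k (f i k x) = x"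
    and fg: "\<And>i k x. i \<le> n \<Longrightarrow> x \<in> carrier (spc (D' i) k) \<Longrightarrow> f i k (g i k x) = x"
    and q: "\<And>i j. i \<le> j \<Longrightarrow> j \<le> n \<Longrightarrow> chain_map K (D i) (D j) (q i j)"
    and q': "\<And>i j. i \<le> j \<Longrightarrow> j \<le> n \<Longrightarrow> chain_map K (D' i) (D' j) (q' i j)"
    and qq: "\<And>i j l k x. i \<le> j \<Longrightarrow> j \<le> l \<Longrightarrow> l \<le> n \<Longrightarrow> x \<in> carrier (spc (D i) k) \<Longrightarrow>
      q j l k (q i j k x) = q i l k x"
    and qq': "\<And>i j l k x. i \<le> j \<Longrightarrow> j \<le> l \<Longrightarrow> l \<le> n \<Longrightarrow> x \<in> carrier (spc (D' i) k) \<Longrightarrow>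
      q' j l k (q' i j k x) = q' i l k x"
    and fq: "\<And>i j k x. i \<le> j \<Longrightarrow> j \<le> n \<Longrightarrow> x \<in> carrier (spc (D i) k) \<Longrightarrow>
      f j k (q i j k x) = q' i j k (f i k x)"
    and \<sigma>: "\<And>t. 0 \<le> t \<Longrightarrow> \<sigma> t \<le> n" "\<And>s t. 0 \<le> s \<Longrightarrow> s \<le> t \<Longrightarrow> \<sigma> s \<le> \<sigma> t"
    and \<sigma>': "\<And>t. 0 \<le> t \<Longrightarrow> \<sigma>' t \<le> n" "\<And>s t. 0 \<le> s \<Longrightarrow> s \<le> t \<Longrightarrow> \<sigma>' s \<le> \<sigma>' t"
    and \<epsilon>: "0 \<le> \<epsilon>" "\<And>t. 0 \<le> t \<Longrightarrow> \<sigma> t \<le> \<sigma>' (t + \<epsilon>)" "\<And>t. 0 \<le> t \<Longrightarrow> \<sigma>' t \<le> \<sigma> (t + \<epsilon>)"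
  shows "\<exists>\<phi> \<psi>. interleaving K \<epsilon>
    \<lparr>obj = (\<lambda>t. D (\<sigma> t)), tr = (\<lambda>s t. q (\<sigma> s) (\<sigma> t))\<rparr>
    \<lparr>obj = (\<lambda>t. D' (\<sigma>' t)), tr = (\<lambda>s t. q' (\<sigma>' s) (\<sigma>' t))\<rparr> \<phi> \<psi>"
proof (intro exI)
  let ?X = "\<lparr>obj = (\<lambda>t. D (\<sigma> t)), tr = (\<lambda>s t. q (\<sigma> s) (\<sigma> t))\<rparr>"
  let ?Y = "\<lparr>obj = (\<lambda>t. D' (\<sigma>' t)), tr = (\<lambda>s t. q' (\<sigma>' s) (\<sigma>' t))\<rparr>"
  let ?\<phi> = "\<lambda>t k x. q' (\<sigma> t) (\<sigma>' (t + \<epsilon>)) k (f (\<sigma> t) k x)"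
  let ?\<psi> = "\<lambda>t k x. q (\<sigma>' t) (\<sigma> (t + \<epsilon>)) k (g (\<sigma>' t) k x)"
  note cl = chain_map_closed[OF f] chain_map_closed[OF g] chain_map_closed[OF q] chain_map_closed[OF q']
  \<comment> \<open>Naturality of the inverses follows from \<open>fq\<close> by cancelling
    \<open>f\<close>.\<close>
  have gq: "g j k (q' i j k x) = q i j k (g i k x)"
    if "i \<le> j" "j \<le> n" "x \<in> carrier (spc (D' i) k)" for i j k x
  proof -
    have "q' i j k x = f j k (q i j k (g i k x))"
      using that by (simp add: fq fg cl)
    then show ?thesis using that by (simp add: gf cl)
  qed
  have \<sigma>le: "\<sigma> t \<le> n" "\<sigma>' t \<le> n" "\<sigma> (t + \<epsilon>) \<le> n" "\<sigma>' (t + \<epsilon>) \<le> n"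
    "\<sigma> (t + 2 * \<epsilon>) \<le> n" "\<sigma>' (t + 2 * \<epsilon>) \<le> n"
    "\<sigma> t \<le> \<sigma>' (t + \<epsilon>)" "\<sigma>' t \<le> \<sigma> (t + \<epsilon>)"
    "\<sigma>' (t + \<epsilon>) \<le> \<sigma> (t + 2 * \<epsilon>)" "\<sigma> (t + \<epsilon>) \<le> \<sigma>' (t + 2 * \<epsilon>)" if "0 \<le> t" for t
    using that \<epsilon>(1) \<epsilon>(2,3)[OF that] \<epsilon>(2,3)[of "t + \<epsilon>"] \<sigma>(1)[of t] \<sigma>'(1)[of t]
      \<sigma>(1)[of "t + \<epsilon>"] \<sigma>'(1)[of "t + \<epsilon>"] \<sigma>(1)[of "t + 2 * \<epsilon>"] \<sigma>'(1)[of "t + 2 * \<epsilon>"]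
    by (simp_all add: add.assoc)
  \<comment> \<open>Reconciles two successive shifts with the parameter of the internal map.\<close>
  have two: "t + \<epsilon> + \<epsilon> = t + 2 * \<epsilon>" for t by simp
  show "interleaving K \<epsilon> ?X ?Y ?\<phi> ?\<psi>"
    unfolding interleaving_def
  proof (intro conjI allI impI ballI)
    show "pmorphism K ?X (shift \<epsilon> ?Y) ?\<phi>"
      unfolding pmorphism_def
    proof (intro conjI allI impI ballI)
      fix t :: real assume "0 \<le> t"
      then show "chain_map K (obj ?X t) (obj (shift \<epsilon> ?Y) t) (?\<phi> t)"
        using \<sigma>le by (auto simp: shift_def intro!: chain_map_comp[OF f q'])
    next
      fix s t k x assume "0 \<le> s" "s \<le> t" "x \<in> carrier (spc (obj ?X s) k)"
      then show "?\<phi> t k (tr ?X s t k x) = tr (shift \<epsilon> ?Y) s t k (?\<phi> s k x)"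
        using \<sigma>le[of s] \<sigma>le[of t] \<sigma>(2) \<sigma>'(2)[of "s + \<epsilon>" "t + \<epsilon>"] \<epsilon>(1)
        by (simp add: shift_def fq qq' cl)
    qed
    show "pmorphism K ?Y (shift \<epsilon> ?X) ?\<psi>"
      unfolding pmorphism_def
    proof (intro conjI allI impI ballI)
      fix t :: real assume "0 \<le> t"
      then show "chain_map K (obj ?Y t) (obj (shift \<epsilon> ?X) t) (?\<psi> t)"
        using \<sigma>le by (auto simp: shift_def intro!: chain_map_comp[OF g q])
    next
      fix s t k x assume "0 \<le> s" "s \<le> t" "x \<in> carrier (spc (obj ?Y s) k)"
      then show "?\<psi> t k (tr ?Y s t k x) = tr (shift \<epsilon> ?X) s t k (?\<psi> s k x)"
        using \<sigma>le[of s] \<sigma>le[of t] \<sigma>'(2) \<sigma>(2)[of "s + \<epsilon>" "t + \<epsilon>"] \<epsilon>(1)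
        by (simp add: shift_def gq qq cl)
    qed
  next
    fix t k x assume "0 \<le> t" "x \<in> carrier (spc (obj ?X t) k)"
    then show "?\<psi> (t + \<epsilon>) k (?\<phi> t k x) = tr ?X t (t + 2 * \<epsilon>) k x"
      using \<sigma>le[of t] by (simp add: two gq gf qq cl)
  next
    fix t k x assume "0 \<le> t" "x \<in> carrier (spc (obj ?Y t) k)"
    then show "?\<phi> (t + \<epsilon>) k (?\<psi> t k x) = tr ?Y t (t + 2 * \<epsilon>) k x"
      using \<sigma>le[of t] by (simp add: two fq fg qq' cl)
  qed
qed

section \<open>Jump times of X\<close>

lemma stage_time_mono:
  assumes "\<And>i. i < length ps \<Longrightarrow> 0 \<le> pair_weight C (ps ! i)" "i \<le> j" "j \<le> length ps"
  shows "stage_time C ps i \<le> stage_time C ps j"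
  unfolding stage_time_def using assms by (intro sum_mono2) auto

text \<open>The current stage is the last one begun by time \<open>t\<close>. Comparing two time
  scales rests on the third property: it suffices to know that a stage has begun.\<close>

lemma stage_at_properties:
  assumes w: "\<And>i. i < length ps \<Longrightarrow> 0 \<le> pair_weight C (ps ! i)" and t: "0 \<le> t"
  shows "stage_at C ps t \<le> length ps" "stage_time C ps (stage_at C ps t) \<le> t"
    "i \<le> length ps \<Longrightarrow> stage_time C ps i \<le> t \<Longrightarrow> i \<le> stage_at C ps t"
proof -
  let ?P = "\<lambda>i. i \<le> length ps \<and> stage_time C ps i \<le> t"
  let ?Q = "\<lambda>i. i \<le> length ps \<and> stage_time C ps i \<le> t \<and> (i < length ps \<longrightarrow> t < stage_time C ps (Suc i))"
  \<comment> \<open>An index meeting the defining condition bounds every stage already begun; this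
    gives both uniqueness and the third property.\<close>
  have max: "j \<le> i" if "?Q i" "?P j" for i j
  proof (rule ccontr)
    assume "\<not> j \<le> i"
    then have "stage_time C ps (Suc i) \<le> stage_time C ps j" using that by (intro stage_time_mono w) auto
    then show False using that \<open>\<not> j \<le> i\<close> by auto
  qed
  have P0: "?P 0" using t by (simp add: stage_time_def)
  define m where "m = Greatest ?P"
  have m: "?P m" unfolding m_def by (rule GreatestI_nat[of ?P 0 "length ps"]) (use P0 in auto)
  have "t < stage_time C ps (Suc m)" if "m < length ps"
  proof (rule ccontr)
    assume "\<not> ?thesis"
    then have "?P (Suc m)" using that by simp
    then have "Suc m \<le> m" unfolding m_def by (rule Greatest_le_nat[of ?P _ "length ps"]) auto
    then show False by simp
  qed
  then have Qm: "?Q m" using m by simp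
  have "?Q (stage_at C ps t)"
    unfolding stage_at_def
  proof (rule theI[of ?Q, OF Qm])
    fix i assume "?Q i"
    then show "i = m" using max[of i m] max[of m i] Qm by auto
  qed
  then show "stage_at C ps t \<le> length ps" "stage_time C ps (stage_at C ps t) \<le> t"
    "i \<le> length ps \<Longrightarrow> stage_time C ps i \<le> t \<Longrightarrow> i \<le> stage_at C ps t"
    using max[of "stage_at C ps t" i] by auto
qed

lemma stage_at_mono:
  assumes w: "\<And>i. i < length ps \<Longrightarrow> 0 \<le> pair_weight C (ps ! i)" and "0 \<le> s" "s \<le> t"
  shows "stage_at C ps s \<le> stage_at C ps t"
proof (rule stage_at_properties(3))
  show "stage_at C ps s \<le> length ps" using assms by (intro stage_at_properties(1))
  show "stage_time C ps (stage_at C ps s) \<le> t" using stage_at_properties(2)[of ps C s] assms by auto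
qed (use assms in auto)

context simplified_iso
begin

lemma X_interleaving:
  assumes simplified': "simplified_pairs K C' ps'"
    and w: "\<And>i. i < length ps \<Longrightarrow> 0 \<le> pair_weight C (ps ! i)"
    and w': "\<And>i. i < length ps \<Longrightarrow> 0 \<le> pair_weight C' (ps' ! i)"
    and d: "\<And>i. i < length ps \<Longrightarrow> \<bar>pair_weight C (ps ! i) - pair_weight C' (ps' ! i)\<bar> \<le> d" and "0 \<le> d"
    and \<epsilon>: "real (length ps) * d \<le> \<epsilon>"
  shows "\<exists>\<phi> \<psi>. interleaving K \<epsilon> (X_complex K C ps) (X_complex K C' ps') \<phi> \<psi>"
proof -
  \<comment> \<open>The identity of \<open>C'\<close> as isomorphism provides the chain map facts
    for the stages of \<open>C'\<close>.\<close>
  interpret R: simplified_iso K C' C' "\<lambda>k b. b" "\<lambda>k x. x" ps'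
    using simplified' based_iso_refl[of K C'] iso by (simp add: simplified_iso_def based_iso_def)
  let ?n = "length ps" and ?D = "stage K C ps" and ?D' = "stage K C' ps'"
  let ?\<sigma> = "stage_at C ps" and ?\<sigma>' = "stage_at C' ps'"
  let ?g = "\<lambda>i k. inv_into (carrier (spc (?D i) k)) (stage_iso i k)"
  have ch: "chain_iso K (?D i) (?D' i) (stage_iso i)" and bc: "based_complex K (?D i)" if "i \<le> ?n" for i
    using based_iso_stage[OF that] by (simp_all add: based_iso_def)
  have bij: "bij_betw (stage_iso i k) (carrier (spc (?D i) k)) (carrier (spc (?D' i) k))" if "i \<le> ?n" for i k
    using ch[OF that] by (simp add: chain_iso_def)
  have w'': "0 \<le> pair_weight C' (ps' ! i)" if "i < length ps'" for i using w' that by simp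
  have s: "?\<sigma> t \<le> ?n" "stage_time C ps (?\<sigma> t) \<le> t"
    "i \<le> ?n \<Longrightarrow> stage_time C ps i \<le> t \<Longrightarrow> i \<le> ?\<sigma> t" if "0 \<le> t" for t i
    using stage_at_properties(1,2)[of ps C t] stage_at_properties(3)[of ps C t i] w that by auto
  have s': "?\<sigma>' t \<le> ?n" "stage_time C' ps' (?\<sigma>' t) \<le> t"
    "i \<le> ?n \<Longrightarrow> stage_time C' ps' i \<le> t \<Longrightarrow> i \<le> ?\<sigma>' t" if "0 \<le> t" for t i
    using stage_at_properties(1,2)[of ps' C' t] stage_at_properties(3)[of ps' C' t i] w'' that by auto
  \<comment> \<open>Each jump time accumulates at most \<open>length ps\<close> errors of size at
    most \<open>d\<close>.\<close>
  have time: "\<bar>stage_time C ps i - stage_time C' ps' i\<bar> \<le> \<epsilon>" if "i \<le> ?n" for i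
  proof -
    have "\<bar>stage_time C ps i - stage_time C' ps' i\<bar> \<le> (\<Sum>j<i. \<bar>pair_weight C (ps ! j) - pair_weight C' (ps' ! j)\<bar>)"
      unfolding stage_time_def sum_subtractf[symmetric] by (rule sum_abs)
    also have "\<dots> \<le> (\<Sum>j<i. d)" using that by (intro sum_mono d) simp
    also have "\<dots> \<le> ?n * d" using that \<open>0 \<le> d\<close> by (simp add: mult_right_mono)
    finally show ?thesis using \<epsilon> by simp
  qed
  have \<epsilon>0: "0 \<le> \<epsilon>" using \<epsilon> \<open>0 \<le> d\<close> by (meson mult_nonneg_nonneg of_nat_0_le_iff order_trans)
  have "\<exists>\<phi> \<psi>. interleaving K \<epsilon>
    \<lparr>obj = (\<lambda>t. cplx.truncate (?D (?\<sigma> t))), tr = (\<lambda>s t. stage_map K C ps (?\<sigma> s) (?\<sigma> t - ?\<sigma> s))\<rparr>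
    \<lparr>obj = (\<lambda>t. cplx.truncate (?D' (?\<sigma>' t))), tr = (\<lambda>s t. stage_map K C' ps' (?\<sigma>' s) (?\<sigma>' t - ?\<sigma>' s))\<rparr> \<phi> \<psi>"
  proof (rule step_interleaving[where f = stage_iso and g = ?g and n = ?n], goal_cases)
    case (1 i) then show ?case using ch by (simp add: chain_iso_def)
  next
    case (2 i) then show ?case
      using chain_iso_inv[OF ch] based_complex_bd_closed[OF bc] by simp
  next
    case (3 i k x) then show ?case using bij by (simp add: bij_betw_def)
  next
    case (4 i k x) then show ?case using bij[of i k] by (simp add: bij_betw_def f_inv_into_f)
  next
    case (5 i j) then show ?case using chain_map_stage_map[of i "j - i"] by simp
  next
    case (6 i j) then show ?case using R.chain_map_stage_map[of i "j - i"] by simp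
  next
    case (7 i j l k x) then show ?case using stage_map_add[of K C ps i "j - i" "l - j" k x] by simp
  next
    case (8 i j l k x) then show ?case using stage_map_add[of K C' ps' i "j - i" "l - j" k x] by simp
  next
    case (9 i j k x) then show ?case using stage_iso_stage_map[of i "j - i" x k] by simp
  next
    case (10 t) then show ?case by (rule s(1))
  next
    case (11 s t) then show ?case using stage_at_mono[of ps C s t] w by auto
  next
    case (12 t) then show ?case by (rule s'(1))
  next
    case (13 s t) then show ?case using stage_at_mono[of ps' C' s t] w'' by auto
  next
    case 14 show ?case by (rule \<epsilon>0)
  next
    \<comment> \<open>The stage of \<open>C\<close> at time \<open>t\<close> has begun by
      \<open>t\<close>, so its counterpart in \<open>C'\<close> has begun by
      \<open>t + \<epsilon>\<close>. The next case is symmetric.\<close>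
    case (15 t)
    then show ?case using s(1,2)[of t] time[of "?\<sigma> t"] \<epsilon>0 by (intro s'(3)) auto
  next
    case (16 t)
    then show ?case using s'(1,2)[of t] time[of "?\<sigma>' t"] \<epsilon>0 by (intro s(3)) auto
  qed
  then show ?thesis by (simp add: X_complex_def)
qed

end

section \<open>Interleavings of the construction Y\<close>

lemma generating_set_image:
  assumes f: "linear_map K V W f" and bij: "bij_betw f (carrier V) (carrier W)"
    and A: "finite A" "A \<subseteq> carrier V" "LinearCombinations.module.span K V A = carrier V"
  shows "finite (f ` A) \<and> card (f ` A) = card A \<and> f ` A \<subseteq> carrier W \<and>
    LinearCombinations.module.span K W (f ` A) = carrier W"
proof -
  interpret V: vectorspace K V using f by (rule linear_map.axioms)
  interpret W: vectorspace K W using f by (rule linear_map.axioms)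
  have inj: "inj_on f A" using bij A(2) by (auto simp: bij_betw_def intro: inj_on_subset)
  have fA: "f ` A \<subseteq> carrier W" using bij A(2) by (auto simp: bij_betw_def)
  have "carrier W \<subseteq> W.span (f ` A)"
  proof
    fix y assume "y \<in> carrier W"
    then obtain x where x: "x \<in> carrier V" "y = f x" using bij by (auto simp: bij_betw_def)
    then obtain c where c: "c \<in> A \<rightarrow> carrier K" "V.lincomb c A = x"
      using V.finite_in_span[OF A(1,2)] A(3) by auto
    define c' where "c' z = c (inv_into A f z)" for z
    have c': "c' \<in> f ` A \<rightarrow> carrier K" using c(1) by (auto simp: c'_def intro!: inv_into_into)
    have c'f: "c' (f g) = c g" if "g \<in> A" for g using inj that by (simp add: c'_def)
    have "y = f (lcomb V A (\<lambda>g. g) c)" using c(2) x(2) by (simp add: V.lincomb_def lcomb_def)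
    also have "\<dots> = lcomb W A f c" using A(2) by (intro lcomb_image[OF f A(1) _ c(1)]) auto
    also have "\<dots> = lcomb W A f (\<lambda>g. c' (f g))" using fA c' by (intro W.lcomb_cong) (auto simp: c'f)
    also have "\<dots> = lcomb W (f ` A) (\<lambda>g. g) c'"
      using inj fA c' by (intro W.lcomb_reindex[symmetric]) (auto simp: bij_betw_def)
    also have "\<dots> = W.lincomb c' (f ` A)" by (simp add: W.lincomb_def lcomb_def)
    finally show "y \<in> W.span (f ` A)" using A(1) c' unfolding W.span_def by blast
  qed
  then show ?thesis using A(1) fA inj card_image W.span_is_subset2[OF fA] by auto
qed

text \<open>Dimension is the least size of a finite generating set, so it suffices to transport
  generating sets of each size in both directions.\<close>

lemma dim_eq_of_bij:
  assumes f: "linear_map K V W f" and bij: "bij_betw f (carrier V) (carrier W)"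
  shows "vectorspace.dim K V = vectorspace.dim K W"
proof -
  interpret V: vectorspace K V using f by (rule linear_map.axioms)
  interpret W: vectorspace K W using f by (rule linear_map.axioms)
  note g = linear_map_inv_into[OF f bij] bij_betw_inv_into[OF bij]
  have "(\<exists>A. finite A \<and> card A = n \<and> A \<subseteq> carrier V \<and> V.span A = carrier V) \<longleftrightarrow>
    (\<exists>A. finite A \<and> card A = n \<and> A \<subseteq> carrier W \<and> W.span A = carrier W)" for n
    using generating_set_image[OF f bij] generating_set_image[OF g] by metis
  then show ?thesis unfolding V.dim_def W.dim_def by simp
qed

section \<open>Direct sums of parametrized complexes\<close>

lemma vectorspace_sum_space:
  assumes "field K" and V: "\<And>i. i \<in> I \<Longrightarrow> vectorspace K (V i)"
  shows "vectorspace K (sum_space I V)"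
proof -
  have *: "Module.module K (V i)" if "i \<in> I" for i using V[OF that] by (rule vectorspace.axioms)
  have ab: "abelian_group (V i)" if "i \<in> I" for i using *[OF that] by (rule module.axioms)
  note closed = abelian_monoid.a_closed[OF abelian_group.axioms(1)[OF ab]]
    abelian_monoid.zero_closed[OF abelian_group.axioms(1)[OF ab]]
    module.smult_closed[OF *] abelian_group.a_inv_closed[OF ab]
  show ?thesis
  proof (rule vs_criteria, goal_cases)
    case 4
    show ?case
    proof
      fix v assume v: "v \<in> carrier (sum_space I V)"
      then have "(\<lambda>i\<in>I. \<ominus>\<^bsub>V i\<^esub> v i) \<in> carrier (sum_space I V)"
        "v \<oplus>\<^bsub>sum_space I V\<^esub> (\<lambda>i\<in>I. \<ominus>\<^bsub>V i\<^esub> v i) = \<zero>\<^bsub>sum_space I V\<^esub>"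
        by (auto simp: sum_space_def PiE_iff closed abelian_group.r_neg[OF ab] intro!: restrict_ext)
      then show "\<exists>w\<in>carrier (sum_space I V). v \<oplus>\<^bsub>sum_space I V\<^esub> w = \<zero>\<^bsub>sum_space I V\<^esub>" by blast
    qed
  next
    \<comment> \<open>Here and in case 10 an arbitrary vector is recovered from its components,
      which relies on vectors of the sum being extensional functions.\<close>
    case 8
    show ?case
      by (auto simp: sum_space_def PiE_iff abelian_monoid.r_zero[OF abelian_group.axioms(1)[OF ab]]
          fun_eq_iff extensional_def)
  next
    case 10
    show ?case
      by (auto simp: sum_space_def PiE_iff module.smult_one[OF *] fun_eq_iff extensional_def)
  next
    case 7
    show ?case
      by (auto simp: sum_space_def PiE_iff closed abelian_monoid.a_assoc[OF abelian_group.axioms(1)[OF ab]]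
          intro!: restrict_ext)
  \<comment> \<open>\<open>field K\<close> is supplied separately because an empty sum has no
    summand to obtain it from.\<close>
  qed (use assms(1) in \<open>auto simp: sum_space_def PiE_iff closed module.smult_assoc1[OF *]
      module.smult_l_distr[OF *] module.smult_r_distr[OF *] intro!: restrict_ext
      intro: abelian_monoid.a_comm[OF abelian_group.axioms(1)[OF ab]]\<close>)
qed

lemma linear_map_sum_space:
  assumes "field K" and f: "\<And>i. i \<in> I \<Longrightarrow> linear_map K (V i) (W i) (f i)"
  shows "linear_map K (sum_space I V) (sum_space I W) (\<lambda>x. \<lambda>i\<in>I. f i (x i))"
proof -
  have hom: "f i \<in> LinearCombinations.module_hom K (V i) (W i)" if "i \<in> I" for i
    using f[OF that] by (auto simp: linear_map_def mod_hom_def mod_hom_axioms_def)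
  note closed = funcset_mem[OF module_hom_closed[OF hom]]
  show ?thesis
  proof (rule linear_mapI)
    show "vectorspace K (sum_space I V)"
      using assms linear_map.axioms(1) by (intro vectorspace_sum_space) blast+
    show "vectorspace K (sum_space I W)"
      using assms linear_map.axioms(2) by (intro vectorspace_sum_space) blast+
  qed (auto simp: sum_space_def PiE_iff closed module_hom_add[OF hom] module_hom_smult[OF hom]
      intro!: restrict_ext)
qed

lemma chain_map_sum_pcplx:
  assumes "field K" and f: "\<And>i. i \<in> I \<Longrightarrow> chain_map K (obj (X i) s) (obj (Y i) t) (f i)"
  shows "chain_map K (obj (sum_pcplx I X) s) (obj (sum_pcplx I Y) t) (\<lambda>k x. \<lambda>i\<in>I. f i k (x i))"
  unfolding chain_map_def
proof (intro conjI allI ballI)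
  show "linear_map K (spc (obj (sum_pcplx I X) s) k) (spc (obj (sum_pcplx I Y) t) k) (\<lambda>x. \<lambda>i\<in>I. f i k (x i))" for k
    using f by (auto simp: sum_pcplx_def chain_map_def intro: linear_map_sum_space[OF assms(1)])
  show "(\<lambda>i\<in>I. f i k (bd (obj (sum_pcplx I X) s) k x i))
      = bd (obj (sum_pcplx I Y) t) k (\<lambda>i\<in>I. f i (Suc k) (x i))"
    if "x \<in> carrier (spc (obj (sum_pcplx I X) s) (Suc k))" for k x
    using f that by (auto simp: sum_pcplx_def chain_map_def sum_space_def PiE_iff intro!: restrict_ext)
qed

lemma shift_sum_pcplx: "shift \<epsilon> (sum_pcplx I X) = sum_pcplx I (\<lambda>i. shift \<epsilon> (X i))"
  by (simp add: shift_def sum_pcplx_def)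

lemma pmorphism_sum_pcplx:
  assumes K: "field K" and mor: "\<And>i. i \<in> I \<Longrightarrow> pmorphism K (X i) (Y i) (\<phi> i)"
  shows "pmorphism K (sum_pcplx I X) (sum_pcplx I Y) (\<lambda>t k x. \<lambda>i\<in>I. \<phi> i t k (x i))"
  unfolding pmorphism_def
proof (intro conjI allI impI ballI)
  fix t :: real assume "0 \<le> t"
  then show "chain_map K (obj (sum_pcplx I X) t) (obj (sum_pcplx I Y) t) (\<lambda>k x. \<lambda>i\<in>I. \<phi> i t k (x i))"
    using mor by (intro chain_map_sum_pcplx[OF K]) (simp add: pmorphism_def)
next
  fix s t k x assume "0 \<le> s" "s \<le> t" "x \<in> carrier (spc (obj (sum_pcplx I X) s) k)"
  then show "(\<lambda>i\<in>I. \<phi> i t k (tr (sum_pcplx I X) s t k x i)) = tr (sum_pcplx I Y) s t k (\<lambda>i\<in>I. \<phi> i s k (x i))"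
    using mor by (auto simp: sum_pcplx_def sum_space_def PiE_iff pmorphism_def intro!: restrict_ext)
qed

text \<open>With a common epsilon the shift commutes with the sum and every condition is checked in
  each component. Errors of different summands therefore do not add up.\<close>

lemma interleaving_sum_pcplx:
  assumes K: "field K" and int: "\<And>i. i \<in> I \<Longrightarrow> interleaving K \<epsilon> (X i) (Y i) (\<phi> i) (\<psi> i)"
  shows "interleaving K \<epsilon> (sum_pcplx I X) (sum_pcplx I Y)
    (\<lambda>t k x. \<lambda>i\<in>I. \<phi> i t k (x i)) (\<lambda>t k x. \<lambda>i\<in>I. \<psi> i t k (x i))"
  unfolding interleaving_def
proof (intro conjI allI impI ballI)
  show "pmorphism K (sum_pcplx I X) (shift \<epsilon> (sum_pcplx I Y)) (\<lambda>t k x. \<lambda>i\<in>I. \<phi> i t k (x i))"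
    unfolding shift_sum_pcplx using int by (intro pmorphism_sum_pcplx K) (simp add: interleaving_def)
  show "pmorphism K (sum_pcplx I Y) (shift \<epsilon> (sum_pcplx I X)) (\<lambda>t k x. \<lambda>i\<in>I. \<psi> i t k (x i))"
    unfolding shift_sum_pcplx using int by (intro pmorphism_sum_pcplx K) (simp add: interleaving_def)
qed (use int in \<open>auto simp: sum_pcplx_def sum_space_def PiE_iff interleaving_def intro!: restrict_ext\<close>)

section \<open>Spheres and disks\<close>

lemma vectorspace_field_space:
  assumes "field K" shows "vectorspace K (field_space K)"
proof -
  interpret field K by fact
  show ?thesis
  proof (rule vs_criteria, goal_cases)
    case 4 show ?case by (auto simp: field_space_def intro!: bexI[of _ "\<ominus>\<^bsub>K\<^esub> x" for x] r_neg)
  qed (auto simp: field_space_def a_ac m_assoc l_distr r_distr field_axioms)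
qed

lemma vectorspace_zero_space:
  assumes "field K" shows "vectorspace K (zero_space K)"
proof -
  interpret field K by fact
  show ?thesis
    by (rule vs_criteria) (auto simp: zero_space_def field_space_def field_axioms)
qed

lemma linear_map_zero_space:
  assumes "vectorspace K V" shows "linear_map K V (zero_space K) (\<lambda>x. \<zero>\<^bsub>K\<^esub>)"
proof -
  interpret vectorspace K V by fact
  show ?thesis
    by (rule linear_mapI) (auto simp: zero_space_def field_space_def assms
        intro: vectorspace_zero_space[unfolded zero_space_def field_space_def, simplified] field_axioms)
qed

lemma vectorspace_disk: "field K \<Longrightarrow> vectorspace K (spc (disk K k) j)"
  by (simp add: disk_def vectorspace_field_space vectorspace_zero_space)

lemma chain_map_to_zero_complex:
  assumes "\<And>j. vectorspace K (spc C j)"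
  shows "chain_map K C (zero_complex K) (\<lambda>j x. \<zero>\<^bsub>K\<^esub>)"
  using assms by (simp add: chain_map_def zero_complex_def linear_map_zero_space)

text \<open>If \<open>t + \<epsilon> < w'\<close>, then \<open>t < w\<close>: whenever the shifted
  target is a disk, so is the source, and the identity is a chain map. Otherwise the target is
  zero.\<close>

lemma pmorphism_interval_disk:
  assumes K: "field K" and w: "w' \<le> w + \<epsilon>"
  shows "pmorphism K (interval_disk K k w) (shift \<epsilon> (interval_disk K k w'))
    (\<lambda>t j x. if t + \<epsilon> < w' then x else \<zero>\<^bsub>K\<^esub>)"
  unfolding pmorphism_def
proof (intro conjI allI impI ballI)
  fix t :: real
  show "chain_map K (obj (interval_disk K k w) t) (obj (shift \<epsilon> (interval_disk K k w')) t)
    (\<lambda>j x. if t + \<epsilon> < w' then x else \<zero>\<^bsub>K\<^esub>)"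
  proof (cases "t + \<epsilon> < w'")
    case True
    then show ?thesis
      using w chain_map_id[OF vectorspace_disk[OF K]] by (simp add: interval_disk_def shift_def)
  next
    case False
    have "vectorspace K (spc (obj (interval_disk K k w) t) j)" for j
      by (simp add: interval_disk_def vectorspace_disk[OF K] zero_complex_def vectorspace_zero_space[OF K])
    from chain_map_to_zero_complex[OF this] show ?thesis
      using False by (simp add: shift_def interval_disk_def)
  qed
qed (use w in \<open>auto simp: interval_disk_def shift_def\<close>)

text \<open>A round trip is the identity while \<open>t + 2 * \<epsilon> < w\<close>, since
  \<open>w'\<close> is at least \<open>w - \<epsilon>\<close> and so the other disk is still present
  at \<open>t + \<epsilon>\<close>. From then on both the round trip and the internal map
  vanish.\<close>

lemma interleaving_interval_disk:
  assumes K: "field K" and \<epsilon>: "0 \<le> \<epsilon>" "\<bar>w - w'\<bar> \<le> \<epsilon>"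
  shows "interleaving K \<epsilon> (interval_disk K k w) (interval_disk K k w')
    (\<lambda>t j x. if t + \<epsilon> < w' then x else \<zero>\<^bsub>K\<^esub>) (\<lambda>t j x. if t + \<epsilon> < w then x else \<zero>\<^bsub>K\<^esub>)"
  unfolding interleaving_def
proof (intro conjI)
  show "pmorphism K (interval_disk K k w) (shift \<epsilon> (interval_disk K k w'))
    (\<lambda>t j x. if t + \<epsilon> < w' then x else \<zero>\<^bsub>K\<^esub>)"
    using \<epsilon> by (intro pmorphism_interval_disk K) simp
  show "pmorphism K (interval_disk K k w') (shift \<epsilon> (interval_disk K k w))
    (\<lambda>t j x. if t + \<epsilon> < w then x else \<zero>\<^bsub>K\<^esub>)"
    using \<epsilon> by (intro pmorphism_interval_disk K) simp
qed (use \<epsilon> in \<open>auto simp: interval_disk_def\<close>)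

lemma interleaving_constant_sphere:
  assumes K: "field K"
  shows "interleaving K \<epsilon> (constant_sphere K k) (constant_sphere K k) (\<lambda>t j x. x) (\<lambda>t j x. x)"
proof -
  have "chain_map K (sphere K k) (sphere K k) (\<lambda>j x. x)"
    by (intro chain_map_id) (simp add: sphere_def vectorspace_field_space[OF K] vectorspace_zero_space[OF K])
  then show ?thesis
    by (simp add: interleaving_def pmorphism_def constant_sphere_def shift_def)
qed

context simplified_iso
begin

text \<open>The spheres are counted by dimensions of the last stage, which the stage isomorphism
  preserves. Both sums thus have the same index set and can be compared summand by summand.\<close>

lemma Y_index_eq: "Y_index K C' ps' = Y_index K C ps"
proof -
  let ?n = "length ps"
  have "chain_iso K (stage K C ps ?n) (stage K C' ps' ?n) (stage_iso ?n)"
    using based_iso_stage[of ?n] by (simp add: based_iso_def)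
  then have "vectorspace.dim K (spc (stage K C ps ?n) k) = vectorspace.dim K (spc (stage K C' ps' ?n) k)" for k
    by (intro dim_eq_of_bij[of K _ _ "stage_iso ?n k"]) (auto simp: chain_iso_def chain_map_def)
  then show ?thesis by (simp add: Y_index_def)
qed

lemma Y_interleaving:
  assumes K: "field K"
    and d: "\<And>i. i < length ps \<Longrightarrow> \<bar>pair_weight C (ps ! i) - pair_weight C' (ps' ! i)\<bar> \<le> \<epsilon>" and "0 \<le> \<epsilon>"
  shows "\<exists>\<phi> \<psi>. interleaving K \<epsilon> (Y_complex K C ps) (Y_complex K C' ps') \<phi> \<psi>"
proof -
  let ?Y = "\<lambda>C ps i. case i of
          Inl l \<Rightarrow> interval_disk K (fst (ps ! l)) (pair_weight C (ps ! l))
        | Inr (k, j) \<Rightarrow> constant_sphere K k"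
  let ?\<phi> = "\<lambda>C ps i t (j :: nat) x. case i of
          Inl l \<Rightarrow> (if t + \<epsilon> < pair_weight C (ps ! l) then x else \<zero>\<^bsub>K\<^esub>)
        | Inr _ \<Rightarrow> x"
  have "interleaving K \<epsilon> (?Y C ps i) (?Y C' ps' i) (?\<phi> C' ps' i) (?\<phi> C ps i)" if "i \<in> Y_index K C ps" for i
  proof (cases i)
    case (Inl l)
    then have l: "l < length ps" using that by (auto simp: Y_index_def)
    \<comment> \<open>\<open>pair_map\<close> keeps degrees, so corresponding disks sit in the same
      degrees and differ only in their endpoints.\<close>
    then have "fst (ps' ! l) = fst (ps ! l)" by (simp add: pair_map_def split: prod.splits)
    then show ?thesis
      unfolding Inl sum.case using interleaving_interval_disk[OF K \<open>0 \<le> \<epsilon>\<close> d[OF l]] by metis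
  next
    case (Inr b)
    show ?thesis
      unfolding Inr sum.case by (cases b) (simp add: interleaving_constant_sphere[OF K])
  qed
  note int = interleaving_sum_pcplx[OF K this]
  show ?thesis
    unfolding Y_complex_def Y_index_eq by (rule exI, rule exI, rule int)
qed

end

section \<open>Stability\<close>

text \<open>Needed for the \<open>Max\<close> in \<open>weight_dist\<close> to be an actual upper
  bound. Compactness gives it: finitely many degrees are non-zero, each has a finite basis, and a
  zero space has an empty one.\<close>

lemma finite_basis_pairs:
  assumes "weighted_based K C"
  shows "finite (basis_pairs C)"
proof -
  have B: "indexed_basis K (spc C k) (gens C k) (elt C k)" for k
    using based_complex_weighted[OF assms] by (simp add: based_complex_def)
  have "gens C k = {}" if triv: "carrier (spc C k) = {\<zero>\<^bsub>spc C k\<^esub>}" for k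
  proof (rule ccontr)
    interpret V: vectorspace K "spc C k" using B[of k] by (simp add: indexed_basis_def)
    assume "gens C k \<noteq> {}"
    then obtain b where b: "b \<in> gens C k" by blast
    let ?c = "coords K (spc C k) (gens C k) (elt C k) (elt C k b)"
    have e: "elt C k \<in> gens C k \<rightarrow> carrier (spc C k)" using B[of k] by (simp add: indexed_basis_def)
    then have b0: "elt C k b = \<zero>\<^bsub>spc C k\<^esub>" using b triv by blast
    have "lcomb (spc C k) (gens C k) (elt C k) (\<lambda>g. \<zero>\<^bsub>K\<^esub>) \<in> carrier (spc C k)"
      using e by (intro V.lcomb_closed) auto
    \<comment> \<open>In a zero space a basis vector would equal the combination with all
      coefficients zero, whereas its own coefficient is one.\<close>
    then have "?c b = \<zero>\<^bsub>K\<^esub>"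
      using triv b b0 by (intro indexed_basis_coords(3)[OF B]) auto
    then show False using coords_basis_vector[OF B b] by simp
  qed
  then have sub: "basis_pairs C \<subseteq>
      (SIGMA k:{k. carrier (spc C k) \<noteq> {\<zero>\<^bsub>spc C k\<^esub>}}. gens C (Suc k) \<times> gens C k)"
    by (auto simp: basis_pairs_def)
  have "finite (gens C k)" for k using B[of k] by (simp add: indexed_basis_def)
  then have "finite (SIGMA k:{k. carrier (spc C k) \<noteq> {\<zero>\<^bsub>spc C k\<^esub>}}. gens C (Suc k) \<times> gens C k)"
    using assms by (intro finite_SigmaI) (auto simp: weighted_based_def compact_complex_def)
  then show ?thesis by (rule finite_subset[OF sub])
qed

theorem lemma2p38:
  fixes K :: "('f, 'm) ring_scheme"
    and C :: "('f, 'v, 'b) wbcplx"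
    and C' :: "('f, 'w, 'c) wbcplx"
    and \<phi> :: "nat \<Rightarrow> 'b \<Rightarrow> 'c"
    and ps :: "(nat \<times> 'b \<times> 'b) list"
  assumes "field K"
    and "weighted_based K C" and "generic C"
    and "weighted_based K C'" and "generic C'"
    and "\<And>k. bij_betw (\<phi> k) (gens C k) (gens C' k)"
    and "induces_iso K C C' \<phi>"
    and "\<And>k a b j c d.
           a \<in> gens C (Suc k) \<Longrightarrow> b \<in> gens C k \<Longrightarrow> c \<in> gens C (Suc j) \<Longrightarrow> d \<in> gens C j \<Longrightarrow>
           wt C k a b < wt C j c d \<longleftrightarrow>
           wt C' k (\<phi> (Suc k) a) (\<phi> k b) < wt C' j (\<phi> (Suc j) c) (\<phi> j d)"
    and "simplified_pairs K C ps"
  shows "simplified_pairs K C' (map (pair_map \<phi>) ps) \<and>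
    interleaving_dist K (X_complex K C ps) (X_complex K C' (map (pair_map \<phi>) ps))
      \<le> ereal (real (length ps) * weight_dist C C' \<phi>) \<and>
    interleaving_dist K (Y_complex K C ps) (Y_complex K C' (map (pair_map \<phi>) ps))
      \<le> ereal (weight_dist C C' \<phi>)"
proof -
  note weighted = assms(2,4)
  let ?ps' = "map (pair_map \<phi>) ps" and ?d = "weight_dist C C' \<phi>"
  obtain f where "chain_iso K C C' f" "\<And>k b. b \<in> gens C k \<Longrightarrow> f k (elt C k b) = elt C' k (\<phi> k b)"
    using assms(7) by (auto simp: induces_iso_def)
  then have iso: "based_iso K C C' \<phi> f"
    using assms(6) weighted by (simp add: based_iso_def based_complex_weighted)
  interpret simplified_iso K C C' \<phi> f ps
    using iso assms(9) by (simp add: simplified_iso_def)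
  have order: "pair_weight C' (pair_map \<phi> p) \<le> pair_weight C' (pair_map \<phi> q)"
    if "p \<in> basis_pairs C" "q \<in> basis_pairs C" "pair_weight C p \<le> pair_weight C q" for p q
  proof -
    obtain k a b j c d where pq: "p = (k, a, b)" "q = (j, c, d)" by (metis prod_cases3)
    with that show ?thesis
      \<comment> \<open>The hypothesis is instantiated with the pairs exchanged and then negated on
        both sides, turning an equivalence of strict inequalities into preservation of the weak
        order.\<close>
      using assms(8)[of c j d a k b] by (auto simp: basis_pairs_def pair_weight_def pair_map_def not_less[symmetric])
  qed
  have simp': "simplified_pairs K C' ?ps'"
    by (rule simplified_pairs_iso[OF iso assms(9) order])
  have mem: "ps ! i \<in> basis_pairs C" if "i < length ps" for i
    by (rule simplified_pairs_basis_pairs[OF assms(9) that])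
  have mem': "?ps' ! i \<in> basis_pairs C'" if "i < length ps" for i
    using simplified_pairs_basis_pairs[OF simp'] that by simp
  have w: "0 \<le> pair_weight C (ps ! i)" "0 \<le> pair_weight C' (?ps' ! i)" if "i < length ps" for i
    using weighted mem[OF that] mem'[OF that] by (simp_all only: weighted_based_def)
  have fin: "finite (insert 0 ((\<lambda>p. \<bar>pair_weight C p - pair_weight C' (pair_map \<phi> p)\<bar>) ` basis_pairs C))"
    using finite_basis_pairs[OF weighted(1)] by simp
  have d0: "0 \<le> ?d" unfolding weight_dist_def by (rule Max_ge[OF fin]) simp
  have d: "\<bar>pair_weight C (ps ! i) - pair_weight C' (?ps' ! i)\<bar> \<le> ?d" if "i < length ps" for i
    unfolding weight_dist_def using mem[OF that] that by (intro Max_ge[OF fin]) auto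
  have "interleaving_dist K (X_complex K C ps) (X_complex K C' ?ps') \<le> ereal (real (length ps) * ?d)"
    by (rule interleaving_dist_le, rule X_interleaving[OF simp' w d d0]) (use d0 in auto)
  moreover have "interleaving_dist K (Y_complex K C ps) (Y_complex K C' ?ps') \<le> ereal ?d"
  proof (rule interleaving_dist_le)
    fix \<epsilon> :: real assume "0 < \<epsilon>" "?d < \<epsilon>"
    then show "\<exists>\<phi>' \<psi>. interleaving K \<epsilon> (Y_complex K C ps) (Y_complex K C' ?ps') \<phi>' \<psi>"
      by (intro Y_interleaving[OF assms(1)] order_trans[OF d]) auto
  qed (rule d0)
  ultimately show ?thesis using simp' by simp
qed

end
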